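(* Let $\lambda>0$ be fixed, and let $(x_j)_{j\in\mathbb{Z}}$ be a sequence of real numbers satisfying the following condition: there exists $q>0$ such that $x_{j+1}-x_j\ge q$ for every integer $j$. Let $A=A_\lambda$ be the bi-infinite matrix whose entries are given by $A(j,k)=e^{-\lambda(x_j-x_k)^2}$, $j,k\in\mathbb{Z}$. Given $l\in\mathbb{Z}$, let the $l$-th fundamental function be defined by $$L_l(x):=\sum_{k\in\mathbb{Z}}A^{-1}(k,l)e^{-\lambda(x-x_k)^2},\qquad x\in\mathbb{R}.$$ The following hold. (i) The function $L_l$ is continuous throughout $\mathbb{R}$. (ii) Each $L_l$ obeys the fundamental interpolatory conditions $L_l(x_m)=\delta_{lm}$, $m\in\mathbb{Z}$. (iii) If, in addition, there exists a positive number $Q$ such that $x_{j+1}-x_j\le Q$ for every integer $j$, then there exist positive constants $\beta_2$ and $\rho$, depending on $\lambda$, $q$, and $Q$, such that $|L_l(x)|\le\beta_2e^{-\rho|x-x_l|}$ for every $x\in\mathbb{R}$ and every $l\in\mathbb{Z}$. (iv) Assume that there exists a positive number $Q$ such that $x_{j+1}-x_j\le Q$ for every integer $j$. Let $(b_l)_{l\in\mathbb{Z}}$ be a sequence satisfying the following condition: there exist a positive number $K$ and a positive integer $P$ such that $|b_l|\le K|l|^P$ for every integer $l$. Then the function $\mathbb{R}\ni x\mapsto\sum_{l\in\mathbb{Z}}b_lL_l(x)$ is continuous on $\mathbb{R}$.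
   Context: The matrix $A$ acts as a bounded, self-adjoint, boundedly invertible operator on $\ell_2(\mathbb{Z})$; $A^{-1}$ denotes its inverse on $\ell_2(\mathbb{Z})$ and $A^{-1}(k,l)$, $k,l\in\mathbb{Z}$, the entries of the matrix of $A^{-1}$ with respect to the standard basis. $\delta_{lm}$ is the Kronecker delta. *)

theory Defs
  imports "HOL-Analysis.Analysis"
begin

text \<open>
  The space of square-summable bi-infinite sequences is taken over the complex scalars.
  The sums over all integers below are unconditional (equivalently, absolutely convergent) sums.
\<close>

definition ell2 :: "(int \<Rightarrow> complex) set" where
  "ell2 = {a. (\<lambda>k. (norm (a k))\<^sup>2) summable_on UNIV}"

definition std_basis :: "int \<Rightarrow> int \<Rightarrow> complex" where
  "std_basis l = (\<lambda>k. if k = l then 1 else 0)"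

definition gauss_matrix :: "real \<Rightarrow> (int \<Rightarrow> real) \<Rightarrow> int \<Rightarrow> int \<Rightarrow> real" where
  "gauss_matrix lam x j k = exp (- lam * (x j - x k)\<^sup>2)"

definition gauss_op :: "real \<Rightarrow> (int \<Rightarrow> real) \<Rightarrow> (int \<Rightarrow> complex) \<Rightarrow> (int \<Rightarrow> complex)" where
  "gauss_op lam x a = (\<lambda>j. \<Sum>\<^sub>\<infinity>k. complex_of_real (gauss_matrix lam x j k) * a k)"

text \<open>
  For \<open>lam > 0\<close> and points \<open>x\<close> with gaps bounded below by a positive number, \<open>gauss_op lam x\<close> is
  a bijection of \<^const>\<open>ell2\<close> onto itself, so that \<^const>\<open>inv_into\<close> is its genuine inverse there.
  The entry \<open>(k, l)\<close> of the matrix of the inverse is the \<open>k\<close>-th coordinate of the image of the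
  \<open>l\<close>-th standard basis vector.
\<close>

definition gauss_inv :: "real \<Rightarrow> (int \<Rightarrow> real) \<Rightarrow> int \<Rightarrow> int \<Rightarrow> complex" where
  "gauss_inv lam x k l = inv_into ell2 (gauss_op lam x) (std_basis l) k"

definition fundamental_fun :: "real \<Rightarrow> (int \<Rightarrow> real) \<Rightarrow> int \<Rightarrow> real \<Rightarrow> complex" where
  "fundamental_fun lam x l t =
     (\<Sum>\<^sub>\<infinity>k. gauss_inv lam x k l * complex_of_real (exp (- lam * (t - x k)\<^sup>2)))"

end

theory Submission
  imports Defs "HOL-Probability.Characteristic_Functions"
begin

text \<open>
  Coercivity of \<open>A\<close> on finitely supported sequences comes from writing the Gaussian as a
  characteristic function and bounding the normal density below, on \<open>[-M, M]\<close>, by a multiple of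
  \<open>M\<^sup>2 - u\<^sup>2\<close>; the Fourier transform of this parabola decays quadratically, so for large \<open>M\<close> the
  diagonal of the resulting form dominates. Conjugating \<open>A\<close> by \<open>exp (\<epsilon> * \<bar>x k - x l\<bar>)\<close>
  for small \<open>\<epsilon>\<close> preserves coercivity (Combes--Thomas), and solving the conjugated system shows that the
  columns of \<open>A\<^sup>-\<^sup>1\<close> decay exponentially in \<open>\<bar>x k - x l\<bar>\<close>. All four claims follow from this
  decay.
\<close>

text \<open>Part (iii) requires constants fixed before the points \<open>x\<close> and the index
  \<open>l\<close>. Coercivity and row sums are therefore bounded uniformly over all separated
  sequences, through finite index sets and with constants that do not see the set. The parabola is
  preferred to a plain indicator because it vanishes at the ends of the interval: the transform of
  an indicator decays only like 1/r, which gives no convergent row sums over separated points. As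
  \<open>M\<close> grows, the diagonal of the parabola form grows like the cube of \<open>M\<close>,
  the bound on its off-diagonal row sums only linearly. The conjugated matrix of the Combes--Thomas
  step is no longer symmetric, so its system is solved by an iteration that asks only for coercivity
  and for bounded row and column sums. The entries of the inverse are defined through
  \<open>inv_into\<close>; the decay of a constructed solution says something about them only once
  that solution is known to be the unique one in \<open>ell2\<close>.\<close>

section \<open>Separated point sequences\<close>

definition separated :: "real \<Rightarrow> (int \<Rightarrow> real) \<Rightarrow> bool" where
  "separated q x \<longleftrightarrow> (\<forall>j k. q * \<bar>real_of_int (j - k)\<bar> \<le> \<bar>x j - x k\<bar>)"

lemma separatedD: "separated q x \<Longrightarrow> q * \<bar>real_of_int (j - k)\<bar> \<le> \<bar>x j - x k\<bar>"
  by (simp add: separated_def)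

lemma separated_scale:
  assumes "separated q x" and "c > 0"
  shows "separated (c * q) (\<lambda>k. c * x k)"
  unfolding separated_def
proof (intro allI)
  fix j k
  show "c * q * \<bar>real_of_int (j - k)\<bar> \<le> \<bar>c * x j - c * x k\<bar>"
    using mult_left_mono[OF separatedD[OF assms(1), of j k], of c] assms(2)
    by (simp add: right_diff_distrib[symmetric] abs_mult mult.assoc)
qed

text \<open>Telescoping the one-step gaps. The pairwise form is the one that the estimates use: it
  is symmetric in \<open>j\<close> and \<open>k\<close> and scales with the points.\<close>

lemma separated_gapI:
  fixes x :: "int \<Rightarrow> real"
  assumes "\<And>j. x (j + 1) - x j \<ge> q"
  shows "separated q x"
  unfolding separated_def
proof (intro allI)
  fix j k
  have up: "q * real_of_int (n - m) \<le> x n - x m" if "m \<le> n" for m n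
    using that
  proof (induction n rule: int_ge_induct)
    case (step i)
    then show ?case using assms[of i] by (simp add: algebra_simps)
  qed simp
  show "q * \<bar>real_of_int (j - k)\<bar> \<le> \<bar>x j - x k\<bar>"
  proof (cases "k \<le> j")
    case True
    then show ?thesis using up[of k j] by simp
  next
    case False
    then show ?thesis using up[of j k] by (simp add: algebra_simps)
  qed
qed

section \<open>Schur test and contraction for coercive matrices\<close>

text \<open>Write \<open>\<bar>M j k\<bar>\<close> as a product of two square roots and apply
  Cauchy--Schwarz in \<open>k\<close>: row sums control one factor and, after exchanging the sums,
  column sums control the other.\<close>

lemma schur_test_finite:
  fixes M :: "'i \<Rightarrow> 'i \<Rightarrow> real"
  assumes row: "\<And>j S. finite S \<Longrightarrow> (\<Sum>k\<in>S. \<bar>M j k\<bar>) \<le> G"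
    and col: "\<And>k S. finite S \<Longrightarrow> (\<Sum>j\<in>S. \<bar>M j k\<bar>) \<le> G"
    and F: "finite F" and S: "finite S"
  shows "(\<Sum>j\<in>F. (\<Sum>k\<in>S. M j k * v k)\<^sup>2) \<le> G\<^sup>2 * (\<Sum>k\<in>S. (v k)\<^sup>2)"
proof -
  have G: "G \<ge> 0" using row[of "{}"] by simp
  have "(\<Sum>k\<in>S. M j k * v k)\<^sup>2 \<le> G * (\<Sum>k\<in>S. \<bar>M j k\<bar> * (v k)\<^sup>2)" for j
  proof -
    have "(\<Sum>k\<in>S. M j k * v k)\<^sup>2 \<le> (\<Sum>k\<in>S. sqrt \<bar>M j k\<bar> * (sqrt \<bar>M j k\<bar> * \<bar>v k\<bar>))\<^sup>2"
    proof (rule abs_le_square_iff[THEN iffD1])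
      have "\<bar>\<Sum>k\<in>S. M j k * v k\<bar> \<le> (\<Sum>k\<in>S. \<bar>M j k * v k\<bar>)" by (rule sum_abs)
      also have "\<dots> = (\<Sum>k\<in>S. sqrt \<bar>M j k\<bar> * (sqrt \<bar>M j k\<bar> * \<bar>v k\<bar>))"
        by (simp add: abs_mult mult.assoc[symmetric])
      finally show "\<bar>\<Sum>k\<in>S. M j k * v k\<bar> \<le> \<bar>\<Sum>k\<in>S. sqrt \<bar>M j k\<bar> * (sqrt \<bar>M j k\<bar> * \<bar>v k\<bar>)\<bar>" by linarith
    qed
    also have "\<dots> \<le> (\<Sum>k\<in>S. (sqrt \<bar>M j k\<bar>)\<^sup>2) * (\<Sum>k\<in>S. (sqrt \<bar>M j k\<bar> * \<bar>v k\<bar>)\<^sup>2)"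
      by (rule Cauchy_Schwarz_ineq_sum)
    also have "\<dots> = (\<Sum>k\<in>S. \<bar>M j k\<bar>) * (\<Sum>k\<in>S. \<bar>M j k\<bar> * (v k)\<^sup>2)"
      by (simp add: power_mult_distrib)
    also have "\<dots> \<le> G * (\<Sum>k\<in>S. \<bar>M j k\<bar> * (v k)\<^sup>2)"
      by (intro mult_right_mono row S sum_nonneg) auto
    finally show ?thesis .
  qed
  then have "(\<Sum>j\<in>F. (\<Sum>k\<in>S. M j k * v k)\<^sup>2) \<le> (\<Sum>j\<in>F. G * (\<Sum>k\<in>S. \<bar>M j k\<bar> * (v k)\<^sup>2))"
    by (rule sum_mono)
  also have "\<dots> = G * (\<Sum>k\<in>S. (\<Sum>j\<in>F. \<bar>M j k\<bar>) * (v k)\<^sup>2)"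
    by (subst sum_distrib_left[symmetric], subst sum.swap) (simp add: sum_distrib_right)
  also have "\<dots> \<le> G * (\<Sum>k\<in>S. G * (v k)\<^sup>2)"
    by (intro mult_left_mono sum_mono mult_right_mono col F G) auto
  also have "\<dots> = G\<^sup>2 * (\<Sum>k\<in>S. (v k)\<^sup>2)"
    by (simp add: sum_distrib_left power2_eq_square mult.assoc)
  finally show ?thesis .
qed

lemma abs_summable_onI_bounded:
  fixes f :: "'i \<Rightarrow> real"
  assumes "\<And>S. finite S \<Longrightarrow> (\<Sum>k\<in>S. \<bar>f k\<bar>) \<le> G"
  shows "(\<lambda>k. \<bar>f k\<bar>) summable_on A" and "(\<Sum>\<^sub>\<infinity>k\<in>A. \<bar>f k\<bar>) \<le> G"
proof -
  show *: "(\<lambda>k. \<bar>f k\<bar>) summable_on A"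
    by (rule nonneg_bdd_above_summable_on) (use assms in \<open>auto intro!: bdd_aboveI2\<close>)
  show "(\<Sum>\<^sub>\<infinity>k\<in>A. \<bar>f k\<bar>) \<le> G"
    using * assms by (intro infsum_le_finite_sums) auto
qed

lemma summable_on_bounded:
  fixes f :: "'i \<Rightarrow> real"
  assumes "\<And>S. finite S \<Longrightarrow> (\<Sum>k\<in>S. \<bar>f k\<bar>) \<le> G"
  shows "f summable_on A"
  by (rule Infinite_Sum.abs_summable_summable)
    (use abs_summable_onI_bounded(1)[where f = f and G = G, OF assms] in simp)

text \<open>Richardson iteration for a coercive, bounded, not necessarily symmetric matrix: with
  \<open>\<tau> = \<theta> / G\<^sup>2\<close> one has \<open>\<parallel>(I - \<tau> M) v\<parallel>\<^sup>2 \<le> (1 - \<theta>\<^sup>2 / G\<^sup>2) \<parallel>v\<parallel>\<^sup>2\<close>.\<close>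

lemma richardson_contraction:
  fixes M :: "'i \<Rightarrow> 'i \<Rightarrow> real"
  assumes row: "\<And>j S. finite S \<Longrightarrow> (\<Sum>k\<in>S. \<bar>M j k\<bar>) \<le> G"
    and col: "\<And>k S. finite S \<Longrightarrow> (\<Sum>j\<in>S. \<bar>M j k\<bar>) \<le> G"
    and coercive: "\<And>S v. finite S \<Longrightarrow> \<theta> * (\<Sum>j\<in>S. (v j)\<^sup>2) \<le> (\<Sum>j\<in>S. \<Sum>k\<in>S. v j * v k * M j k)"
    and \<theta>: "0 < \<theta>" "\<theta> \<le> G"
    and v: "\<And>S. finite S \<Longrightarrow> (\<Sum>k\<in>S. (v k)\<^sup>2) \<le> N"
    and F: "finite F"
  shows "(\<Sum>j\<in>F. (v j - \<theta> / G\<^sup>2 * (\<Sum>\<^sub>\<infinity>k. M j k * v k))\<^sup>2) \<le> (1 - \<theta>\<^sup>2 / G\<^sup>2) * N"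
proof -
  define \<tau> where "\<tau> = \<theta> / G\<^sup>2"
  have G: "G > 0" and \<tau>: "\<tau> > 0" using \<theta> by (auto simp: \<tau>_def)
  have r: "1 - \<theta>\<^sup>2 / G\<^sup>2 \<ge> 0" using \<theta> G by (simp add: power_mono)
  \<comment> \<open>Coercivity concerns square finite sections, so the outer index is enlarged from
    \<open>F\<close> to the truncation set \<open>S\<close> of the inner sum. Afterwards
    \<open>F\<close> stays fixed while \<open>S\<close> exhausts the index set, and the bound
    survives the limit.\<close>
  have fin: "(\<Sum>j\<in>F. (v j - \<tau> * (\<Sum>k\<in>S. M j k * v k))\<^sup>2) \<le> (1 - \<theta>\<^sup>2 / G\<^sup>2) * N"
    if S: "finite S" "F \<subseteq> S" for S
  proof -
    have "(\<Sum>j\<in>F. (v j - \<tau> * (\<Sum>k\<in>S. M j k * v k))\<^sup>2) \<le> (\<Sum>j\<in>S. (v j - \<tau> * (\<Sum>k\<in>S. M j k * v k))\<^sup>2)"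
      using S by (intro sum_mono2) auto
    also have "\<dots> = (\<Sum>j\<in>S. (v j)\<^sup>2) - 2 * \<tau> * (\<Sum>j\<in>S. \<Sum>k\<in>S. v j * v k * M j k)
                     + \<tau>\<^sup>2 * (\<Sum>j\<in>S. (\<Sum>k\<in>S. M j k * v k)\<^sup>2)"
    proof -
      have "(v j - \<tau> * (\<Sum>k\<in>S. M j k * v k))\<^sup>2 =
          (v j)\<^sup>2 - 2 * \<tau> * (\<Sum>k\<in>S. v j * v k * M j k) + \<tau>\<^sup>2 * (\<Sum>k\<in>S. M j k * v k)\<^sup>2" for j
      proof -
        have "(\<Sum>k\<in>S. v j * v k * M j k) = v j * (\<Sum>k\<in>S. M j k * v k)"
          by (simp add: sum_distrib_left mult_ac)
        then show ?thesis by (simp add: power2_eq_square algebra_simps)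
      qed
      then show ?thesis by (simp add: sum.distrib sum_subtractf sum_distrib_left)
    qed
    also have "\<dots> \<le> (\<Sum>j\<in>S. (v j)\<^sup>2) - 2 * \<tau> * (\<theta> * (\<Sum>j\<in>S. (v j)\<^sup>2)) + \<tau>\<^sup>2 * (G\<^sup>2 * (\<Sum>j\<in>S. (v j)\<^sup>2))"
      using \<tau> by (intro add_mono diff_mono order_refl mult_left_mono coercive schur_test_finite[OF row col] S) auto
    \<comment> \<open>The chosen \<open>\<tau>\<close> minimises the factor
      \<open>1 - 2 * \<tau> * \<theta> + \<tau>\<^sup>2 * G\<^sup>2\<close>.\<close>
    also have "\<dots> = (1 - \<theta>\<^sup>2 / G\<^sup>2) * (\<Sum>j\<in>S. (v j)\<^sup>2)"
      using G by (simp add: \<tau>_def field_simps power2_eq_square)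
    also have "\<dots> \<le> (1 - \<theta>\<^sup>2 / G\<^sup>2) * N"
      by (intro mult_left_mono r v S)
    finally show ?thesis .
  qed
  have sm: "(\<lambda>k. M j k * v k) summable_on UNIV" for j
  proof (rule summable_on_bounded)
    fix S :: "'i set" assume "finite S"
    have "\<bar>v k\<bar> \<le> sqrt N" for k
      using v[of "{k}"] by (simp add: real_le_rsqrt)
    then have "(\<Sum>k\<in>S. \<bar>M j k * v k\<bar>) \<le> (\<Sum>k\<in>S. \<bar>M j k\<bar> * sqrt N)"
      by (auto simp: abs_mult intro!: sum_mono mult_left_mono)
    also have "\<dots> \<le> G * sqrt N"
      unfolding sum_distrib_right[symmetric] using v[of "{}"] \<open>finite S\<close>
      by (intro mult_right_mono row) auto
    finally show "(\<Sum>k\<in>S. \<bar>M j k * v k\<bar>) \<le> G * sqrt N" .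
  qed
  have "((\<lambda>S. \<Sum>j\<in>F. (v j - \<tau> * (\<Sum>k\<in>S. M j k * v k))\<^sup>2) \<longlongrightarrow>
          (\<Sum>j\<in>F. (v j - \<tau> * (\<Sum>\<^sub>\<infinity>k. M j k * v k))\<^sup>2)) (finite_subsets_at_top UNIV)"
    by (intro tendsto_intros infsum_tendsto sm)
  moreover have "\<forall>\<^sub>F S in finite_subsets_at_top UNIV.
      (\<Sum>j\<in>F. (v j - \<tau> * (\<Sum>k\<in>S. M j k * v k))\<^sup>2) \<le> (1 - \<theta>\<^sup>2 / G\<^sup>2) * N"
    unfolding eventually_finite_subsets_at_top using fin F by blast
  ultimately show ?thesis unfolding \<tau>_def[symmetric]
    by (rule tendsto_upperbound) simp
qed

section \<open>Coercivity of the Gaussian form; exponential sums over separated points\<close>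

text \<open>The map \<open>\<lambda>m. nat \<bar>m\<bar>\<close> is injective on each of the two
  half-lines, hence the factor 2.\<close>

lemma sum_nat_abs_le:
  fixes f :: "nat \<Rightarrow> real" and F :: "int set"
  assumes f: "summable f" and nonneg: "\<And>n. 0 \<le> f n" and F: "finite F"
  shows "(\<Sum>m\<in>F. f (nat \<bar>m\<bar>)) \<le> 2 * suminf f"
proof -
  have *: "(\<Sum>m\<in>G. f (nat \<bar>m\<bar>)) \<le> suminf f"
    if "finite G" "inj_on (\<lambda>m. nat \<bar>m\<bar>) G" for G :: "int set"
  proof -
    have "(\<Sum>m\<in>G. f (nat \<bar>m\<bar>)) = sum f ((\<lambda>m. nat \<bar>m\<bar>) ` G)"
      using that by (simp add: sum.reindex)
    also have "\<dots> \<le> suminf f"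
      using that f nonneg by (intro sum_le_suminf) auto
    finally show ?thesis .
  qed
  have "(\<Sum>m\<in>F. f (nat \<bar>m\<bar>)) = (\<Sum>m\<in>F \<inter> {0..}. f (nat \<bar>m\<bar>)) + (\<Sum>m\<in>F - {0..}. f (nat \<bar>m\<bar>))"
    using F by (rule sum.Int_Diff)
  also have "\<dots> \<le> suminf f + suminf f"
    using F by (intro add_mono *) (auto simp: inj_on_def)
  finally show ?thesis by simp
qed

lemma has_bochner_integral_parabola:
  fixes M :: real
  assumes "M > 0"
  shows "has_bochner_integral lborel (\<lambda>u. (M\<^sup>2 - u\<^sup>2) * indicator {-M..M} u) (4 * M ^ 3 / 3)"
proof -
  define F where "F = (\<lambda>u::real. M\<^sup>2 * u - u ^ 3 / 3)"
  have "has_bochner_integral lborel (\<lambda>u. (M\<^sup>2 - u\<^sup>2) * indicator {-M..M} u) (F M - F (-M))"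
    using assms unfolding F_def
    by (intro has_bochner_integral_FTC_Icc_real)
       (auto intro!: derivative_eq_intros continuous_intros simp: power2_eq_square)
  then show ?thesis by (simp add: F_def power2_eq_square power3_eq_cube mult.assoc)
qed

text \<open>Two integrations by parts give the antiderivative \<open>F\<close>. Its term of order
  1/r carries the factor \<open>M\<^sup>2 - u\<^sup>2\<close> and disappears at both endpoints,
  which leaves quadratic decay.\<close>

lemma has_bochner_integral_parabola_cos:
  fixes M r :: real
  assumes "M > 0" "r \<noteq> 0"
  shows "has_bochner_integral lborel (\<lambda>u. (M\<^sup>2 - u\<^sup>2) * cos (r * u) * indicator {-M..M} u)
           (4 * sin (r * M) / r ^ 3 - 4 * M * cos (r * M) / r\<^sup>2)"
proof -
  define F where "F = (\<lambda>u::real. (M\<^sup>2 - u\<^sup>2) * sin (r * u) / r - 2 * u * cos (r * u) / r\<^sup>2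
                          + 2 * sin (r * u) / r ^ 3)"
  have "(F has_real_derivative (M\<^sup>2 - u\<^sup>2) * cos (r * u)) (at u)" for u
    unfolding F_def
    by (rule derivative_eq_intros refl | use assms in \<open>simp add: field_simps power2_eq_square power3_eq_cube\<close>)+
  then have "has_bochner_integral lborel (\<lambda>u. (M\<^sup>2 - u\<^sup>2) * cos (r * u) * indicator {-M..M} u) (F M - F (-M))"
    using assms by (intro has_bochner_integral_FTC_Icc_real) (auto intro!: continuous_intros)
  then show ?thesis by (simp add: F_def algebra_simps)
qed

text \<open>Estimating the sine by its argument trades one power of \<open>r\<close> for a factor
  \<open>M\<close>, so that both terms have the same order. The result is linear in
  \<open>M\<close>.\<close>

lemma parabola_transform_bound:
  fixes M r :: real
  assumes "M > 0" "r \<noteq> 0"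
  shows "\<bar>4 * sin (r * M) / r ^ 3 - 4 * M * cos (r * M) / r\<^sup>2\<bar> \<le> 8 * M / r\<^sup>2"
proof -
  have "\<bar>4 * sin (r * M) / r ^ 3\<bar> \<le> 4 * (\<bar>r\<bar> * M) / \<bar>r\<bar> ^ 3"
    using abs_sin_x_le_abs_x[of "r * M"] assms
    by (auto simp: abs_mult power_abs intro!: divide_right_mono)
  also have "\<dots> = 4 * M / r\<^sup>2"
    using assms by (simp add: power3_eq_cube power2_eq_square field_simps)
  finally have 1: "\<bar>4 * sin (r * M) / r ^ 3\<bar> \<le> 4 * M / r\<^sup>2" .
  have 2: "\<bar>4 * M * cos (r * M) / r\<^sup>2\<bar> \<le> 4 * M / r\<^sup>2"
    using abs_cos_le_one[of "r * M"] assms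
    by (auto simp: abs_mult intro!: divide_right_mono)
  have "\<bar>4 * sin (r * M) / r ^ 3 - 4 * M * cos (r * M) / r\<^sup>2\<bar> \<le> 4 * M / r\<^sup>2 + 4 * M / r\<^sup>2"
    using abs_triangle_ineq4 add_mono[OF 1 2] by (rule order_trans)
  then show ?thesis by simp
qed

text \<open>Both sides equal the squared modulus of the exponential sum with coefficients
  \<open>a j\<close> and frequencies \<open>y j\<close>. Its nonnegativity is what allows the
  density to be replaced by a smaller weight.\<close>

lemma sum_sum_cos_diff:
  fixes a y :: "'i \<Rightarrow> real"
  shows "(\<Sum>j\<in>S. \<Sum>k\<in>S. a j * a k * cos ((y j - y k) * u)) =
           (\<Sum>j\<in>S. a j * cos (y j * u))\<^sup>2 + (\<Sum>j\<in>S. a j * sin (y j * u))\<^sup>2"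
  by (simp add: power2_eq_square sum_product sum.distrib[symmetric] left_diff_distrib cos_diff
      algebra_simps)

text \<open>The real part of the characteristic function. It exhibits the Gaussian kernel as an
  average of the positive semidefinite cosine kernels.\<close>

lemma integral_cos_std_normal:
  "(LINT u|std_normal_distribution. cos (r * u)) = exp (- r\<^sup>2 / 2)"
proof -
  have "integrable std_normal_distribution (\<lambda>u. iexp (r * u))"
    using real_dist_normal_dist
    by (intro finite_measure.integrable_const_bound[where B = 1])
       (auto simp: real_distribution_def prob_space_def finite_measure_def norm_exp_i_times)
  then have "Re (CLINT u|std_normal_distribution. iexp (r * u)) = (LINT u|std_normal_distribution. Re (iexp (r * u)))"
    by simp
  moreover have "Re (iexp (r * u)) = cos (r * u)" for u
    by (simp add: Re_exp)
  ultimately show ?thesis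
    using fun_cong[OF char_std_normal_distribution, of r] by (simp add: char_def)
qed

text \<open>By the arithmetic-geometric mean inequality each product splits into two halves, and
  symmetry of \<open>B\<close> makes their sums equal. It serves to absorb off-diagonal terms here
  and the perturbation caused by the conjugation later.\<close>

lemma schur_symmetric:
  fixes a :: "'i \<Rightarrow> real"
  assumes sym: "\<And>j k. B j k = B k j" and nonneg: "\<And>j k. 0 \<le> B j k"
    and row: "\<And>j. j \<in> S \<Longrightarrow> (\<Sum>k\<in>S. B j k) \<le> G"
  shows "(\<Sum>j\<in>S. \<Sum>k\<in>S. B j k * \<bar>a j * a k\<bar>) \<le> G * (\<Sum>j\<in>S. (a j)\<^sup>2)"
proof -
  have am: "\<bar>s * t\<bar> \<le> (s\<^sup>2 + t\<^sup>2) / 2" for s t :: real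
    using sum_squares_bound[of "\<bar>s\<bar>" "\<bar>t\<bar>"] by (simp add: abs_mult)
  have "(\<Sum>j\<in>S. \<Sum>k\<in>S. B j k * \<bar>a j * a k\<bar>) \<le> (\<Sum>j\<in>S. \<Sum>k\<in>S. B j k * (((a j)\<^sup>2 + (a k)\<^sup>2) / 2))"
    by (intro sum_mono mult_left_mono am nonneg)
  also have "\<dots> = (\<Sum>j\<in>S. \<Sum>k\<in>S. B j k * (a j)\<^sup>2) / 2 + (\<Sum>j\<in>S. \<Sum>k\<in>S. B j k * (a k)\<^sup>2) / 2"
    by (simp add: sum_divide_distrib sum.distrib[symmetric] field_simps)
  also have "(\<Sum>j\<in>S. \<Sum>k\<in>S. B j k * (a k)\<^sup>2) = (\<Sum>j\<in>S. \<Sum>k\<in>S. B j k * (a j)\<^sup>2)"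
    by (subst sum.swap) (simp add: sym)
  also have "(\<Sum>j\<in>S. \<Sum>k\<in>S. B j k * (a j)\<^sup>2) = (\<Sum>j\<in>S. (\<Sum>k\<in>S. B j k) * (a j)\<^sup>2)"
    by (simp add: sum_distrib_right)
  also have "\<dots> / 2 + \<dots> / 2 = \<dots>" by simp
  also have "\<dots> \<le> (\<Sum>j\<in>S. G * (a j)\<^sup>2)"
    by (intro sum_mono mult_right_mono row) auto
  finally show ?thesis by (simp add: sum_distrib_left)
qed

lemma gauss_form_lower_bound_normalized:
  fixes q :: real
  assumes q: "q > 0"
  obtains \<theta> :: real where "\<theta> > 0"
    "\<And>(y :: int \<Rightarrow> real) S a. separated q y \<Longrightarrow> finite S \<Longrightarrow>
       \<theta> * (\<Sum>j\<in>S. (a j)\<^sup>2) \<le> (\<Sum>j\<in>S. \<Sum>k\<in>S. a j * a k * exp (- (y j - y k)\<^sup>2 / 2))"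
proof -
  \<comment> \<open>Bounds the sum of \<open>1 / (j - k)\<^sup>2\<close> over all \<open>k\<close>.
    Since division by zero yields 0, the term \<open>k = j\<close> contributes nothing; for the same
    reason the matrix \<open>B\<close> below vanishes on the diagonal.\<close>
  define Z where "Z = 2 * (\<Sum>n. 1 / (real n)\<^sup>2)"
  have sm: "summable (\<lambda>n. 1 / (real n)\<^sup>2)"
    using inverse_power_summable[of 2, where 'a = real] by (simp add: field_simps)
  have Zsum: "(\<Sum>k\<in>S. 1 / (real_of_int (j - k))\<^sup>2) \<le> Z" if "finite S" for S :: "int set" and j
  proof -
    have "(\<Sum>k\<in>S. 1 / (real_of_int (j - k))\<^sup>2) = (\<Sum>m\<in>(\<lambda>k. j - k) ` S. 1 / (real_of_int m)\<^sup>2)"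
      by (subst sum.reindex) (auto simp: inj_on_def)
    also have "\<dots> = (\<Sum>m\<in>(\<lambda>k. j - k) ` S. 1 / (real (nat \<bar>m\<bar>))\<^sup>2)"
      by (simp add: of_nat_nat)
    also have "\<dots> \<le> Z" unfolding Z_def
      by (rule sum_nat_abs_le[OF sm]) (use that in auto)
    finally show ?thesis .
  qed
  have Z0: "Z \<ge> 0" using Zsum[of "{}"] by simp
  \<comment> \<open>Chosen so that \<open>8 * M / q\<^sup>2 * (Z + 1)\<close> equals
    \<open>2 * M ^ 3 / 3\<close>, half of the diagonal value \<open>4 * M ^ 3 / 3\<close>. The
    off-diagonal part then costs at most half of the diagonal; the summand 1 keeps \<open>M\<close>
    positive.\<close>
  define M where "M = sqrt (12 * (Z + 1) / q\<^sup>2)"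
  have M: "M > 0" and M2: "M\<^sup>2 = 12 * (Z + 1) / q\<^sup>2"
    using Z0 q by (auto simp: M_def)
  \<comment> \<open>With this factor \<open>\<kappa> * (M\<^sup>2 - u\<^sup>2)\<close> is at most
    the density at \<open>M\<close>, which is the minimum of the density on the interval.\<close>
  define \<kappa> where "\<kappa> = std_normal_density M / M\<^sup>2"
  have \<kappa>: "\<kappa> > 0" using M by (simp add: \<kappa>_def normal_density_pos)
  \<comment> \<open>The closed form would evaluate to 0 at \<open>r = 0\<close>, so the diagonal
    value has to be given separately.\<close>
  define d where "d = (\<lambda>r. if r = 0 then 4 * M ^ 3 / 3
                           else 4 * sin (r * M) / r ^ 3 - 4 * M * cos (r * M) / r\<^sup>2)"
  have d: "has_bochner_integral lborel (\<lambda>u. (M\<^sup>2 - u\<^sup>2) * cos (r * u) * indicator {-M..M} u) (d r)" for r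
    using has_bochner_integral_parabola[OF M] has_bochner_integral_parabola_cos[OF M, of r]
    by (cases "r = 0") (auto simp: d_def)
  show ?thesis
  proof (rule that[of "\<kappa> * (2 * M ^ 3 / 3)"])
    show "\<kappa> * (2 * M ^ 3 / 3) > 0" using \<kappa> M by simp
    fix y :: "int \<Rightarrow> real" and S a
    assume sep: "separated q y" and S: "finite (S :: int set)"
    define P where "P = (\<lambda>u. \<Sum>j\<in>S. \<Sum>k\<in>S. a j * a k * cos ((y j - y k) * u))"
    have P0: "P u \<ge> 0" for u unfolding P_def sum_sum_cos_diff by simp
    have hP: "(M\<^sup>2 - u\<^sup>2) * indicator {-M..M} u * P u =
        (\<Sum>j\<in>S. \<Sum>k\<in>S. a j * a k * ((M\<^sup>2 - u\<^sup>2) * cos ((y j - y k) * u) * indicator {-M..M} u))" for u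
      by (simp only: P_def sum_distrib_left mult_ac)
    have int_cos: "integrable std_normal_distribution (\<lambda>u. cos (r * u))" for r
      using real_dist_normal_dist
      by (intro finite_measure.integrable_const_bound[where B = 1])
         (auto simp: real_distribution_def prob_space_def finite_measure_def)
    have intP: "integrable std_normal_distribution P"
      unfolding P_def by (intro Bochner_Integration.integrable_sum integrable_mult_right int_cos)
    have "(\<Sum>j\<in>S. \<Sum>k\<in>S. a j * a k * exp (- (y j - y k)\<^sup>2 / 2)) = (LINT u|std_normal_distribution. P u)"
      unfolding P_def
      by (subst Bochner_Integration.integral_sum,
          intro Bochner_Integration.integrable_sum integrable_mult_right int_cos,
          intro sum.cong refl, subst Bochner_Integration.integral_sum,
          intro integrable_mult_right int_cos)
         (simp add: integral_cos_std_normal)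
    also have "\<dots> = (LINT u|lborel. std_normal_density u * P u)"
      by (subst integral_density) (auto simp: P_def)
    also have "\<dots> \<ge> (LINT u|lborel. \<kappa> * ((M\<^sup>2 - u\<^sup>2) * indicator {-M..M} u * P u))"
    proof (rule integral_mono)
      show "integrable lborel (\<lambda>u. std_normal_density u * P u)"
        using intP by (subst (asm) integrable_density) (auto simp: P_def)
      have "integrable lborel (\<lambda>u. \<Sum>j\<in>S. \<Sum>k\<in>S. a j * a k * ((M\<^sup>2 - u\<^sup>2) * cos ((y j - y k) * u) * indicator {-M..M} u))"
        by (intro Bochner_Integration.integrable_sum integrable_mult_right)
           (use d in \<open>auto simp: has_bochner_integral_iff\<close>)
      then show "integrable lborel (\<lambda>u. \<kappa> * ((M\<^sup>2 - u\<^sup>2) * indicator {-M..M} u * P u))"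
        by (intro integrable_mult_right) (simp only: hP)
      show "\<kappa> * ((M\<^sup>2 - u\<^sup>2) * indicator {-M..M} u * P u) \<le> std_normal_density u * P u" for u
      proof (cases "u \<in> {-M..M}")
        case True
        then have u: "u\<^sup>2 \<le> M\<^sup>2" using M by (intro abs_le_square_iff[THEN iffD1]) auto
        have "\<kappa> * (M\<^sup>2 - u\<^sup>2) \<le> \<kappa> * M\<^sup>2" using \<kappa> by (intro mult_left_mono) auto
        also have "\<dots> = std_normal_density M" using M by (simp add: \<kappa>_def)
        also have "\<dots> \<le> std_normal_density u"
          using u by (auto simp: std_normal_density_def intro!: divide_right_mono)
        finally have "\<kappa> * (M\<^sup>2 - u\<^sup>2) * P u \<le> std_normal_density u * P u"
          by (rule mult_right_mono[OF _ P0])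
        then show ?thesis using True by (simp add: mult.assoc)
      qed (use P0 in \<open>auto simp: normal_density_nonneg\<close>)
    qed
    also have "(LINT u|lborel. \<kappa> * ((M\<^sup>2 - u\<^sup>2) * indicator {-M..M} u * P u)) =
        \<kappa> * (LINT u|lborel. (\<Sum>j\<in>S. \<Sum>k\<in>S. a j * a k * ((M\<^sup>2 - u\<^sup>2) * cos ((y j - y k) * u) * indicator {-M..M} u)))"
      by (simp only: integral_mult_right_zero hP)
    also have "(LINT u|lborel. (\<Sum>j\<in>S. \<Sum>k\<in>S. a j * a k * ((M\<^sup>2 - u\<^sup>2) * cos ((y j - y k) * u) * indicator {-M..M} u)))
        = (\<Sum>j\<in>S. \<Sum>k\<in>S. a j * a k * d (y j - y k))"
      by (intro has_bochner_integral_integral_eq has_bochner_integral_sum has_bochner_integral_mult_right d)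
    finally have lower: "\<kappa> * (\<Sum>j\<in>S. \<Sum>k\<in>S. a j * a k * d (y j - y k)) \<le>
        (\<Sum>j\<in>S. \<Sum>k\<in>S. a j * a k * exp (- (y j - y k)\<^sup>2 / 2))" .
    have "2 * M ^ 3 / 3 * (\<Sum>j\<in>S. (a j)\<^sup>2) \<le> (\<Sum>j\<in>S. \<Sum>k\<in>S. a j * a k * d (y j - y k))"
    proof -
      define B where "B = (\<lambda>j k :: int. 8 * M / q\<^sup>2 * (1 / (real_of_int (j - k))\<^sup>2))"
      have "a j * a k * d (y j - y k) \<ge> (if j = k then 4 * M ^ 3 / 3 * (a j)\<^sup>2 else 0) - B j k * \<bar>a j * a k\<bar>" for j k
      proof (cases "j = k")
        case True
        then show ?thesis by (simp add: B_def d_def power2_eq_square)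
      next
        case False
        then have "0 < q * \<bar>real_of_int (j - k)\<bar>" using q by simp
        with separatedD[OF sep, of j k] have ne: "y j - y k \<noteq> 0" and "(q * \<bar>real_of_int (j - k)\<bar>)\<^sup>2 \<le> (y j - y k)\<^sup>2"
          by (auto intro!: abs_le_square_iff[THEN iffD1])
        then have "8 * M / (y j - y k)\<^sup>2 \<le> 8 * M / (q\<^sup>2 * (real_of_int (j - k))\<^sup>2)"
          using M q False by (intro divide_left_mono) (auto simp: power_mult_distrib)
        with parabola_transform_bound[OF M ne] ne have "\<bar>d (y j - y k)\<bar> \<le> B j k"
          by (simp add: d_def B_def)
        then have "\<bar>a j * a k * d (y j - y k)\<bar> \<le> B j k * \<bar>a j * a k\<bar>"
          by (simp add: abs_mult mult.commute[of _ "\<bar>d _\<bar>"] mult_right_mono)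
        then show ?thesis using False by auto
      qed
      then have "(\<Sum>j\<in>S. \<Sum>k\<in>S. a j * a k * d (y j - y k)) \<ge>
         (\<Sum>j\<in>S. \<Sum>k\<in>S. (if j = k then 4 * M ^ 3 / 3 * (a j)\<^sup>2 else 0) - B j k * \<bar>a j * a k\<bar>)"
        by (intro sum_mono)
      moreover have "(\<Sum>j\<in>S. \<Sum>k\<in>S. (if j = k then 4 * M ^ 3 / 3 * (a j)\<^sup>2 else 0) - B j k * \<bar>a j * a k\<bar>) =
         4 * M ^ 3 / 3 * (\<Sum>j\<in>S. (a j)\<^sup>2) - (\<Sum>j\<in>S. \<Sum>k\<in>S. B j k * \<bar>a j * a k\<bar>)"
        using S by (simp add: sum_subtractf sum_distrib_left)
      moreover have "(\<Sum>j\<in>S. \<Sum>k\<in>S. B j k * \<bar>a j * a k\<bar>) \<le> (8 * M / q\<^sup>2 * Z) * (\<Sum>j\<in>S. (a j)\<^sup>2)"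
      proof (rule schur_symmetric)
        show "B j k = B k j" for j k by (simp add: B_def power2_commute)
        show "0 \<le> B j k" for j k using M by (simp add: B_def)
        show "sum (B j) S \<le> 8 * M / q\<^sup>2 * Z" for j
          using Zsum[OF S, of j] M unfolding B_def sum_distrib_left[symmetric]
          by (intro mult_left_mono) auto
      qed
      moreover have "8 * M / q\<^sup>2 * Z \<le> 2 * M ^ 3 / 3"
      proof -
        have "2 * M ^ 3 / 3 = M * (2 / 3) * M\<^sup>2" by (simp add: power3_eq_cube power2_eq_square)
        also have "\<dots> = 8 * M / q\<^sup>2 * (Z + 1)" unfolding M2 using q by (simp add: field_simps)
        finally show ?thesis using M q by (simp add: divide_right_mono mult_left_mono)
      qed
      then have "(8 * M / q\<^sup>2 * Z) * (\<Sum>j\<in>S. (a j)\<^sup>2) \<le> 2 * M ^ 3 / 3 * (\<Sum>j\<in>S. (a j)\<^sup>2)"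
        by (intro mult_right_mono sum_nonneg) auto
      ultimately show ?thesis by linarith
    qed
    then show "\<kappa> * (2 * M ^ 3 / 3) * (\<Sum>j\<in>S. (a j)\<^sup>2) \<le> (\<Sum>j\<in>S. \<Sum>k\<in>S. a j * a k * exp (- (y j - y k)\<^sup>2 / 2))"
      using \<kappa> lower by (simp only: mult.assoc) (meson mult_left_mono less_imp_le order_trans)
  qed
qed

text \<open>Comparison with the point of \<open>F\<close> closest to \<open>t\<close> makes the bound independent of \<open>t\<close>.\<close>

lemma separated_exp_sum_bound:
  fixes q :: real
  assumes q: "q > 0"
  obtains H where "H > 0"
    "\<And>(x :: int \<Rightarrow> real) t F. separated q x \<Longrightarrow> finite F \<Longrightarrow>
       (\<Sum>k\<in>F. exp (- \<bar>t - x k\<bar>)) \<le> H"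
proof -
  \<comment> \<open>The rate is halved because \<open>x i\<close> will be the point closest to
    \<open>t\<close>: then \<open>\<bar>x k - x i\<bar>\<close> is at most twice
    \<open>\<bar>t - x k\<bar>\<close>.\<close>
  define f where "f = (\<lambda>n::nat. exp (- (q / 2)) ^ n)"
  have f: "summable f" "\<And>n. 0 \<le> f n"
    unfolding f_def using q by (auto intro!: summable_geometric)
  show ?thesis
  proof (rule that[of "2 * suminf f + 1"])
    show "2 * suminf f + 1 > 0" using suminf_nonneg[OF f] by simp
    fix x :: "int \<Rightarrow> real" and t F
    assume sep: "separated q x" and F: "finite (F :: int set)"
    show "(\<Sum>k\<in>F. exp (- \<bar>t - x k\<bar>)) \<le> 2 * suminf f + 1"
    proof (cases "F = {}")
      case True
      then show ?thesis using suminf_nonneg[OF f] by simp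
    next
      case False
      define i where "i = arg_min_on (\<lambda>k. \<bar>t - x k\<bar>) F"
      have i: "\<bar>t - x i\<bar> \<le> \<bar>t - x k\<bar>" if "k \<in> F" for k
        using arg_min_least[OF F False that] by (simp add: i_def)
      have "exp (- \<bar>t - x k\<bar>) \<le> f (nat \<bar>k - i\<bar>)" if "k \<in> F" for k
      proof -
        have "q / 2 * \<bar>real_of_int (k - i)\<bar> \<le> \<bar>t - x k\<bar>"
          using separatedD[OF sep, of k i] i[OF that] by linarith
        then have "exp (- \<bar>t - x k\<bar>) \<le> exp (- (q / 2) * \<bar>real_of_int (k - i)\<bar>)" by simp
        also have "\<dots> = f (nat \<bar>k - i\<bar>)"
          by (simp add: f_def exp_of_nat_mult[symmetric] of_nat_nat mult.commute)
        finally show ?thesis .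
      qed
      then have "(\<Sum>k\<in>F. exp (- \<bar>t - x k\<bar>)) \<le> (\<Sum>k\<in>F. f (nat \<bar>k - i\<bar>))"
        by (rule sum_mono)
      also have "\<dots> = (\<Sum>m\<in>(\<lambda>k. k - i) ` F. f (nat \<bar>m\<bar>))"
        by (subst sum.reindex) (auto simp: inj_on_def)
      also have "\<dots> \<le> 2 * suminf f"
        using F by (intro sum_nat_abs_le f) auto
      finally show ?thesis by simp
    qed
  qed
qed

section \<open>Exponentially decaying solutions of the Gaussian system\<close>

text \<open>The solution is the Neumann series with terms \<open>v n\<close>, where
  \<open>v 0\<close> is \<open>\<tau>\<close> times a basis vector and \<open>v (Suc n)\<close>
  arises from \<open>v n\<close> by applying I - \<tau> M. Each step shrinks the square-sum norm by
  \<open>sqrt r\<close>, so the geometric series gives the bound. As \<open>v n - v (Suc n)\<close>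
  is \<tau> M applied to \<open>v n\<close>, applying M to the series makes it telescope.\<close>

lemma coercive_matrix_column_of_inverse:
  fixes M :: "'i \<Rightarrow> 'i \<Rightarrow> real"
  assumes row: "\<And>j S. finite S \<Longrightarrow> (\<Sum>k\<in>S. \<bar>M j k\<bar>) \<le> G"
    and col: "\<And>k S. finite S \<Longrightarrow> (\<Sum>j\<in>S. \<bar>M j k\<bar>) \<le> G"
    and coercive: "\<And>S v. finite S \<Longrightarrow> \<theta> * (\<Sum>j\<in>S. (v j)\<^sup>2) \<le> (\<Sum>j\<in>S. \<Sum>k\<in>S. v j * v k * M j k)"
    and \<theta>: "0 < \<theta>" "\<theta> \<le> G"
  obtains u where "\<And>k. \<bar>u k\<bar> \<le> \<theta> / G\<^sup>2 / (1 - sqrt (1 - \<theta>\<^sup>2 / G\<^sup>2))"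
    and "\<And>j. (\<Sum>\<^sub>\<infinity>k. M j k * u k) = (if j = l then 1 else 0)"
proof -
  define \<tau> where "\<tau> = \<theta> / G\<^sup>2"
  define r where "r = 1 - \<theta>\<^sup>2 / G\<^sup>2"
  have G: "G > 0" and \<tau>: "\<tau> > 0" using \<theta> by (auto simp: \<tau>_def)
  have r: "0 \<le> r" "r < 1" unfolding r_def using \<theta> G by (simp_all add: power_mono)
  define v where "v = rec_nat (\<lambda>j. if j = l then \<tau> else 0)
                        (\<lambda>_ w j. w j - \<tau> * (\<Sum>\<^sub>\<infinity>k. M j k * w k))"
  have v0: "v 0 = (\<lambda>j. if j = l then \<tau> else 0)"
    and vS: "v (Suc n) = (\<lambda>j. v n j - \<tau> * (\<Sum>\<^sub>\<infinity>k. M j k * v n k))" for n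
    by (simp_all add: v_def)
  have vn: "(\<Sum>j\<in>S. (v n j)\<^sup>2) \<le> r ^ n * \<tau>\<^sup>2" if "finite S" for S n
    using that
  proof (induction n arbitrary: S)
    case 0
    have "(\<Sum>j\<in>S. (v 0 j)\<^sup>2) = (\<Sum>j\<in>S. if j = l then \<tau>\<^sup>2 else 0)"
      by (intro sum.cong) (auto simp: v0)
    also have "\<dots> \<le> \<tau>\<^sup>2" using 0 by simp
    finally show ?case by simp
  next
    case (Suc n)
    show ?case
      using richardson_contraction[where M = M and v = "v n" and N = "r ^ n * \<tau>\<^sup>2" and F = S, OF row col coercive \<theta> Suc.IH Suc.prems]
      by (simp add: vS r_def[symmetric] \<tau>_def[symmetric] mult.assoc)
  qed
  have vb: "\<bar>v n k\<bar> \<le> \<tau> * sqrt r ^ n" for n k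
  proof -
    have "\<bar>v n k\<bar> \<le> sqrt (r ^ n * \<tau>\<^sup>2)"
      using vn[of "{k}" n] by (intro real_le_rsqrt) simp
    then show ?thesis using \<tau> by (simp add: real_sqrt_mult real_sqrt_power mult.commute)
  qed
  have geo: "((\<lambda>n. \<tau> * sqrt r ^ n) has_sum \<tau> * (1 / (1 - sqrt r))) UNIV"
    using r by (intro has_sum_cmult_right norm_summable_imp_has_sum geometric_sums)
       (auto simp: real_sqrt_lt_1_iff norm_power intro!: summable_geometric)
  have vsm: "(\<lambda>n. \<bar>v n k\<bar>) summable_on UNIV" for k
    by (rule summable_on_comparison_test[OF has_sum_imp_summable[OF geo]]) (simp_all add: vb)
  have vs: "(\<lambda>n. v n k) summable_on UNIV" for k
    by (rule Infinite_Sum.abs_summable_summable) (simp add: vsm)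
  define u where "u = (\<lambda>k. \<Sum>\<^sub>\<infinity>n. v n k)"
  show ?thesis
  proof (rule that[of u])
    show "\<bar>u k\<bar> \<le> \<theta> / G\<^sup>2 / (1 - sqrt (1 - \<theta>\<^sup>2 / G\<^sup>2))" for k
    proof -
      have "\<bar>u k\<bar> \<le> (\<Sum>\<^sub>\<infinity>n. \<bar>v n k\<bar>)"
        using norm_infsum_bound[of "\<lambda>n. v n k" UNIV] vsm[of k] by (simp add: u_def)
      also have "\<dots> \<le> (\<Sum>\<^sub>\<infinity>n. \<tau> * sqrt r ^ n)"
        using vsm[of k] has_sum_imp_summable[OF geo] by (intro infsum_mono vb) auto
      also have "\<dots> = \<tau> / (1 - sqrt r)" using infsumI[OF geo] by simp
      finally show ?thesis by (simp add: \<tau>_def r_def)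
    qed
    show "(\<Sum>\<^sub>\<infinity>k. M j k * u k) = (if j = l then 1 else 0)" for j
    proof -
      have Mj: "(\<lambda>k. \<bar>M j k\<bar>) summable_on UNIV"
        by (rule abs_summable_onI_bounded[OF row])
      \<comment> \<open>Exchanging the sums needs absolute convergence over pairs: the majorant is a
        summable row of \<open>M\<close> times a geometric sequence.\<close>
      have prod: "(\<lambda>(k, n). M j k * v n k) summable_on UNIV \<times> UNIV"
      proof (rule Infinite_Sum.abs_summable_summable, rule Infinite_Sum.abs_summable_on_comparison_test')
        show "(\<lambda>(k, n). \<bar>M j k\<bar> * (\<tau> * sqrt r ^ n)) summable_on UNIV \<times> UNIV"
        proof (rule summable_on_SigmaI)
          fix k
          show "((\<lambda>n. case (k, n) of (k, n) \<Rightarrow> \<bar>M j k\<bar> * (\<tau> * sqrt r ^ n)) has_sum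
                  \<bar>M j k\<bar> * (\<tau> * (1 / (1 - sqrt r)))) UNIV"
            unfolding prod.case by (rule has_sum_cmult_right[OF geo])
        next
          show "(\<lambda>k. \<bar>M j k\<bar> * (\<tau> * (1 / (1 - sqrt r)))) summable_on UNIV"
            using Mj by (rule summable_on_cmult_left)
        qed (use r \<tau> in auto)
      qed (auto simp: abs_mult intro!: mult_left_mono vb)
      have "(\<Sum>\<^sub>\<infinity>k. M j k * u k) = (\<Sum>\<^sub>\<infinity>k. \<Sum>\<^sub>\<infinity>n. M j k * v n k)"
        unfolding u_def using vs by (simp add: infsum_cmult_right)
      also have "\<dots> = (\<Sum>\<^sub>\<infinity>n. \<Sum>\<^sub>\<infinity>k. M j k * v n k)"
        by (rule infsum_swap_banach[OF prod])
      also have "\<dots> = (\<Sum>\<^sub>\<infinity>n. (v n j - v (Suc n) j) / \<tau>)"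
        using \<tau> by (simp add: vS)
      also have "\<dots> = v 0 j / \<tau>"
      proof -
        have "(\<lambda>n. v n j) \<longlonglongrightarrow> 0"
          by (intro summable_LIMSEQ_zero summable_on_imp_summable vs)
        then have "(\<lambda>n. (v n j - v (Suc n) j) / \<tau>) sums ((v 0 j - 0) / \<tau>)"
          by (intro sums_divide telescope_sums')
        \<comment> \<open>Telescoping yields ordered convergence only; the unordered sum requires
          absolute convergence as well.\<close>
        moreover have "summable (\<lambda>n. norm ((v n j - v (Suc n) j) / \<tau>))"
        proof (rule summable_comparison_test')
          have s: "summable (\<lambda>n. \<bar>v n j\<bar>)" by (rule summable_on_imp_summable[OF vsm])
          then have "summable (\<lambda>n. \<bar>v (Suc n) j\<bar>)" by (subst summable_Suc_iff)
          with s show "summable (\<lambda>n. (\<bar>v n j\<bar> + \<bar>v (Suc n) j\<bar>) / \<tau>)"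
            by (intro summable_divide summable_add)
          show "norm (norm ((v n j - v (Suc n) j) / \<tau>)) \<le> (\<bar>v n j\<bar> + \<bar>v (Suc n) j\<bar>) / \<tau>" for n
            using \<tau> abs_triangle_ineq4[of "v n j" "v (Suc n) j"] by (simp add: divide_right_mono)
        qed
        ultimately have "((\<lambda>n. (v n j - v (Suc n) j) / \<tau>) has_sum ((v 0 j - 0) / \<tau>)) UNIV"
          by (rule norm_summable_imp_has_sum[rotated])
        from infsumI[OF this] show ?thesis by simp
      qed
      also have "\<dots> = (if j = l then 1 else 0)" using \<tau> by (simp add: v0)
      finally show ?thesis .
    qed
  qed
qed

lemma separated_exp_summable:
  fixes x :: "int \<Rightarrow> real"
  assumes q: "q > 0" and \<epsilon>: "\<epsilon> > 0"
    and sep: "separated q x"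
  shows "(\<lambda>k. exp (- \<epsilon> * \<bar>x k - t\<bar>)) summable_on A"
proof -
  obtain H where "H > 0" and H: "\<And>(y :: int \<Rightarrow> real) s F. separated (\<epsilon> * q) y \<Longrightarrow>
      finite F \<Longrightarrow> (\<Sum>k\<in>F. exp (- \<bar>s - y k\<bar>)) \<le> H"
    using separated_exp_sum_bound[OF mult_pos_pos[OF \<epsilon> q]] by blast
  note H = H[OF separated_scale[OF sep \<epsilon>]]
  show ?thesis
  proof (rule summable_on_bounded)
    fix S :: "int set" assume S: "finite S"
    have "\<epsilon> * \<bar>x k - t\<bar> = \<bar>\<epsilon> * t - \<epsilon> * x k\<bar>" for k
      using \<epsilon> by (simp add: right_diff_distrib[symmetric] abs_mult abs_minus_commute)
    then show "(\<Sum>k\<in>S. \<bar>exp (- \<epsilon> * \<bar>x k - t\<bar>)\<bar>) \<le> H"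
      using H[OF S, of "\<epsilon> * t"] by simp
  qed
qed

text \<open>Completing the square gives \<open>\<bar>s\<bar> - lam * s\<^sup>2 \<le> 1 / lam -
  \<bar>s\<bar>\<close>. The growing factor is room kept for exponential weights of rate at most 1,
  both in the conjugation and when decay passes from the coefficients to the fundamental
  functions.\<close>

lemma separated_gauss_sum_bound:
  fixes q lam :: real
  assumes q: "q > 0" and lam: "lam > 0"
  obtains G where "G > 0"
    "\<And>(x :: int \<Rightarrow> real) t F. separated q x \<Longrightarrow> finite F \<Longrightarrow>
       (\<Sum>k\<in>F. exp (\<bar>t - x k\<bar> - lam * (t - x k)\<^sup>2)) \<le> G"
proof -
  obtain H where H: "H > 0" "\<And>(x :: int \<Rightarrow> real) t F. separated q x \<Longrightarrow>
      finite F \<Longrightarrow> (\<Sum>k\<in>F. exp (- \<bar>t - x k\<bar>)) \<le> H"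
    using separated_exp_sum_bound[OF q] by blast
  show ?thesis
  proof (rule that[of "exp (1 / lam) * H"])
    show "exp (1 / lam) * H > 0" using H by simp
    fix x :: "int \<Rightarrow> real" and t F
    assume sep: "separated q x" and F: "finite (F :: int set)"
    have "exp (\<bar>s\<bar> - lam * s\<^sup>2) \<le> exp (1 / lam) * exp (- \<bar>s\<bar>)" for s
    proof -
      have "0 \<le> (lam * \<bar>s\<bar> - 1)\<^sup>2 / lam" using lam by simp
      also have "\<dots> = lam * s\<^sup>2 - 2 * \<bar>s\<bar> + 1 / lam"
        using lam by (simp add: power2_eq_square field_simps)
      finally have "\<bar>s\<bar> - lam * s\<^sup>2 \<le> 1 / lam - \<bar>s\<bar>" by simp
      then show ?thesis by (simp add: exp_add[symmetric])
    qed
    then have "(\<Sum>k\<in>F. exp (\<bar>t - x k\<bar> - lam * (t - x k)\<^sup>2)) \<le> (\<Sum>k\<in>F. exp (1 / lam) * exp (- \<bar>t - x k\<bar>))"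
      by (intro sum_mono)
    also have "\<dots> \<le> exp (1 / lam) * H"
      unfolding sum_distrib_left[symmetric] using H(2)[OF sep F] by simp
    finally show "(\<Sum>k\<in>F. exp (\<bar>t - x k\<bar> - lam * (t - x k)\<^sup>2)) \<le> exp (1 / lam) * H" .
  qed
qed

lemma gauss_form_lower_bound:
  fixes q lam :: real
  assumes q: "q > 0" and lam: "lam > 0"
  obtains \<theta> :: real where "\<theta> > 0"
    "\<And>(x :: int \<Rightarrow> real) S v. separated q x \<Longrightarrow> finite S \<Longrightarrow>
       \<theta> * (\<Sum>j\<in>S. (v j)\<^sup>2) \<le> (\<Sum>j\<in>S. \<Sum>k\<in>S. v j * v k * gauss_matrix lam x j k)"
proof -
  define s where "s = sqrt (2 * lam)"
  have s: "s > 0" "s\<^sup>2 = 2 * lam" using lam by (auto simp: s_def)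
  obtain \<theta> :: real where \<theta>: "\<theta> > 0"
    "\<And>(y :: int \<Rightarrow> real) S v. separated (s * q) y \<Longrightarrow> finite S \<Longrightarrow>
       \<theta> * (\<Sum>j\<in>S. (v j)\<^sup>2) \<le> (\<Sum>j\<in>S. \<Sum>k\<in>S. v j * v k * exp (- (y j - y k)\<^sup>2 / 2))"
    using gauss_form_lower_bound_normalized[OF mult_pos_pos[OF s(1) q]] by blast
  show ?thesis
  proof (rule that[OF \<theta>(1)])
    fix x :: "int \<Rightarrow> real" and S v
    assume sep: "separated q x" and S: "finite (S :: int set)"
    from \<theta>(2)[OF separated_scale[OF sep s(1)] S, of v]
    have "\<theta> * (\<Sum>j\<in>S. (v j)\<^sup>2) \<le> (\<Sum>j\<in>S. \<Sum>k\<in>S. v j * v k * exp (- (s * x j - s * x k)\<^sup>2 / 2))" .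
    moreover have "- (s * x j - s * x k)\<^sup>2 / 2 = - lam * (x j - x k)\<^sup>2" for j k
      by (simp add: right_diff_distrib[symmetric] power_mult_distrib s)
    ultimately show "\<theta> * (\<Sum>j\<in>S. (v j)\<^sup>2) \<le> (\<Sum>j\<in>S. \<Sum>k\<in>S. v j * v k * gauss_matrix lam x j k)"
      by (simp only: gauss_matrix_def)
  qed
qed

text \<open>Convexity of exp between 0 and \<open>r\<close> pulls the small parameter out of the
  exponent. The price \<open>exp r\<close> is free of \<epsilon>, so a perturbation bounded this way
  becomes small with \<epsilon>.\<close>

lemma abs_exp_minus_one_le:
  fixes s r \<epsilon> :: real
  assumes "\<bar>s\<bar> \<le> \<epsilon> * r" "0 \<le> \<epsilon>" "\<epsilon> \<le> 1"
  shows "\<bar>exp s - 1\<bar> \<le> \<epsilon> * exp r"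
proof -
  have "2 \<le> exp s + exp (- s)"
    using cosh_real_ge_1[of s] by (simp add: cosh_def)
  then have "\<bar>exp s - 1\<bar> \<le> exp \<bar>s\<bar> - 1" by (cases "s \<ge> 0") auto
  also have "\<dots> \<le> exp (\<epsilon> * r) - 1" using assms by simp
  also have "exp (\<epsilon> * r) = exp ((1 - \<epsilon>) *\<^sub>R 0 + \<epsilon> *\<^sub>R r)" by simp
  also have "\<dots> \<le> (1 - \<epsilon>) * exp 0 + \<epsilon> * exp r"
    by (rule convex_onD[OF exp_convex]) (use assms in auto)
  finally show ?thesis using assms by simp
qed

text \<open>The weight \<open>w\<close> is 1-Lipschitz in the points whatever \<open>l\<close> is,
  so the conjugated matrix \<open>B\<close> is close to \<open>A\<close> uniformly in
  \<open>l\<close>. A merely bounded solution \<open>u\<close> of the conjugated system turns into a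
  decaying one when the weight is undone.\<close>

lemma gauss_decaying_solution:
  fixes q lam :: real
  assumes q: "q > 0" and lam: "lam > 0"
  obtains C \<epsilon> :: real where "C > 0" "0 < \<epsilon>" "\<epsilon> \<le> 1"
    "\<And>(x :: int \<Rightarrow> real) l. separated q x \<Longrightarrow>
       \<exists>c. (\<forall>k. \<bar>c k\<bar> \<le> C * exp (- \<epsilon> * \<bar>x k - x l\<bar>)) \<and>
           (\<forall>j. (\<Sum>\<^sub>\<infinity>k. gauss_matrix lam x j k * c k) = (if j = l then 1 else 0))"
proof -
  obtain \<theta> :: real where \<theta>: "\<theta> > 0"
    "\<And>(x :: int \<Rightarrow> real) S v. separated q x \<Longrightarrow> finite S \<Longrightarrow>
       \<theta> * (\<Sum>j\<in>S. (v j)\<^sup>2) \<le> (\<Sum>j\<in>S. \<Sum>k\<in>S. v j * v k * gauss_matrix lam x j k)"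
    using gauss_form_lower_bound[OF q lam] by blast
  obtain G where G: "G > 0"
    "\<And>(x :: int \<Rightarrow> real) t F. separated q x \<Longrightarrow> finite F \<Longrightarrow>
       (\<Sum>k\<in>F. exp (\<bar>t - x k\<bar> - lam * (t - x k)\<^sup>2)) \<le> G"
    using separated_gauss_sum_bound[OF q lam] by blast
  \<comment> \<open>The bound 1 fits the room left in the Gaussian sums; the other one limits the
    perturbation to half of the coercivity constant.\<close>
  define \<epsilon> where "\<epsilon> = min 1 (\<theta> / (2 * G))"
  have \<epsilon>: "0 < \<epsilon>" "\<epsilon> \<le> 1" using \<theta>(1) G(1) by (auto simp: \<epsilon>_def)
  have "\<epsilon> \<le> \<theta> / (2 * G)" by (simp add: \<epsilon>_def)
  then have \<epsilon>G: "\<epsilon> * G \<le> \<theta> / 2" using G(1) by (simp add: field_simps)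
  define \<theta>' where "\<theta>' = \<theta> / 2"
  \<comment> \<open>Adding \<open>\<theta>'\<close> secures \<open>\<theta>' \<le> G'\<close>, as
    the iteration demands.\<close>
  define G' where "G' = G + \<theta>'"
  have \<theta>': "0 < \<theta>'" "\<theta>' \<le> G'" using \<theta>(1) G(1) by (auto simp: \<theta>'_def G'_def)
  define C where "C = max 1 (\<theta>' / G'\<^sup>2 / (1 - sqrt (1 - \<theta>'\<^sup>2 / G'\<^sup>2)))"
  have C: "C > 0" by (simp add: C_def)
  have main: "\<exists>c. (\<forall>k. \<bar>c k\<bar> \<le> C * exp (- \<epsilon> * \<bar>x k - x l\<bar>)) \<and>
           (\<forall>j. (\<Sum>\<^sub>\<infinity>k. gauss_matrix lam x j k * c k) = (if j = l then 1 else 0))"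
    if sep: "separated q x" for x :: "int \<Rightarrow> real" and l
  proof -
    define A where "A = gauss_matrix lam x"
    define w where "w = (\<lambda>k. \<bar>x k - x l\<bar>)"
    define B where "B = (\<lambda>j k. A j k * exp (\<epsilon> * (w j - w k)))"
    have A: "A j k = exp (- lam * (x j - x k)\<^sup>2)" "A j k \<ge> 0" "A j k = A k j" for j k
      by (simp_all add: A_def gauss_matrix_def power2_commute)
    have w: "\<bar>\<epsilon> * (w j - w k)\<bar> \<le> \<epsilon> * \<bar>x j - x k\<bar>" for j k
      using \<epsilon> by (auto simp: abs_mult w_def intro!: mult_left_mono)
    have "\<bar>B j k\<bar> \<le> exp (\<bar>x j - x k\<bar> - lam * (x j - x k)\<^sup>2)" for j k
    proof -
      have "\<epsilon> * (w j - w k) \<le> 1 * \<bar>x j - x k\<bar>"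
        using w[of j k] mult_right_mono[OF \<epsilon>(2), of "\<bar>x j - x k\<bar>"] by auto
      then show ?thesis by (simp add: B_def A(1) exp_add[symmetric])
    qed
    note B = this
    have row: "(\<Sum>k\<in>S. \<bar>B j k\<bar>) \<le> G'" if "finite S" for j S
    proof -
      have "(\<Sum>k\<in>S. \<bar>B j k\<bar>) \<le> (\<Sum>k\<in>S. exp (\<bar>x j - x k\<bar> - lam * (x j - x k)\<^sup>2))"
        by (intro sum_mono B)
      with G(2)[OF sep that, of "x j"] show ?thesis using \<theta>' by (simp add: G'_def)
    qed
    have col: "(\<Sum>j\<in>S. \<bar>B j k\<bar>) \<le> G'" if "finite S" for k S
    proof -
      have "(\<Sum>j\<in>S. \<bar>B j k\<bar>) \<le> (\<Sum>j\<in>S. exp (\<bar>x k - x j\<bar> - lam * (x k - x j)\<^sup>2))"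
        using B by (intro sum_mono) (simp add: abs_minus_commute power2_commute)
      with G(2)[OF sep that, of "x k"] show ?thesis using \<theta>' by (simp add: G'_def)
    qed
    have coercive: "\<theta>' * (\<Sum>j\<in>S. (v j)\<^sup>2) \<le> (\<Sum>j\<in>S. \<Sum>k\<in>S. v j * v k * B j k)"
      if S: "finite S" for S v
    proof -
      define E where "E = (\<lambda>j k. A j k * (\<epsilon> * exp \<bar>x j - x k\<bar>))"
      have "v j * v k * B j k \<ge> v j * v k * A j k - E j k * \<bar>v j * v k\<bar>" for j k
      proof -
        have "B j k - A j k = A j k * (exp (\<epsilon> * (w j - w k)) - 1)"
          by (simp add: B_def right_diff_distrib)
        then have "\<bar>B j k - A j k\<bar> = A j k * \<bar>exp (\<epsilon> * (w j - w k)) - 1\<bar>"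
          using A(2)[of j k] by (simp add: abs_mult)
        also have "\<dots> \<le> E j k" unfolding E_def
          using abs_exp_minus_one_le[OF w] \<epsilon> A(2) by (intro mult_left_mono) auto
        finally have "\<bar>v j * v k * (B j k - A j k)\<bar> \<le> E j k * \<bar>v j * v k\<bar>"
          unfolding abs_mult[of "v j * v k"] by (subst mult.commute) (rule mult_right_mono, auto)
        then show ?thesis by (simp add: right_diff_distrib)
      qed
      then have "(\<Sum>j\<in>S. \<Sum>k\<in>S. v j * v k * A j k - E j k * \<bar>v j * v k\<bar>) \<le> (\<Sum>j\<in>S. \<Sum>k\<in>S. v j * v k * B j k)"
        by (intro sum_mono)
      moreover have "(\<Sum>j\<in>S. \<Sum>k\<in>S. E j k * \<bar>v j * v k\<bar>) \<le> \<theta> / 2 * (\<Sum>j\<in>S. (v j)\<^sup>2)"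
      proof (rule schur_symmetric)
        show "E j k = E k j" for j k
          using A(3)[of j k] by (simp add: E_def abs_minus_commute)
        show "0 \<le> E j k" for j k using A(2) \<epsilon> by (simp add: E_def)
        show "sum (E j) S \<le> \<theta> / 2" for j
        proof -
          have "sum (E j) S = \<epsilon> * (\<Sum>k\<in>S. exp (\<bar>x j - x k\<bar> - lam * (x j - x k)\<^sup>2))"
            by (simp add: E_def A(1) sum_distrib_left exp_diff exp_minus field_simps)
          also have "\<dots> \<le> \<epsilon> * G" using \<epsilon> by (intro mult_left_mono G(2)[OF sep S]) auto
          finally show ?thesis using \<epsilon>G by linarith
        qed
      qed
      moreover have "\<theta> * (\<Sum>j\<in>S. (v j)\<^sup>2) \<le> (\<Sum>j\<in>S. \<Sum>k\<in>S. v j * v k * A j k)"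
        unfolding A_def by (rule \<theta>(2)[OF sep S])
      ultimately show ?thesis by (simp add: sum_subtractf \<theta>'_def)
    qed
    obtain u where u: "\<And>k. \<bar>u k\<bar> \<le> \<theta>' / G'\<^sup>2 / (1 - sqrt (1 - \<theta>'\<^sup>2 / G'\<^sup>2))"
      "\<And>j. (\<Sum>\<^sub>\<infinity>k. B j k * u k) = (if j = l then 1 else 0)"
      using coercive_matrix_column_of_inverse[where M = B and G = G' and \<theta> = \<theta>' and l = l,
          OF row col coercive \<theta>'] by blast
    show ?thesis
    proof (intro exI[of _ "\<lambda>k. exp (- \<epsilon> * w k) * u k"] conjI allI)
      fix k
      have "\<bar>u k\<bar> \<le> C" using u(1)[of k] by (simp add: C_def)
      then show "\<bar>exp (- \<epsilon> * w k) * u k\<bar> \<le> C * exp (- \<epsilon> * \<bar>x k - x l\<bar>)"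
        by (simp add: abs_mult w_def mult.commute)
    next
      fix j
      \<comment> \<open>The outer factor \<open>exp (- \<epsilon> * w j)\<close> does not disturb
        the right-hand side: it is 1 at \<open>j = l\<close>, where \<open>w\<close> vanishes, and
        elsewhere it multiplies 0.\<close>
      have "A j k * (exp (- \<epsilon> * w k) * u k) = exp (- \<epsilon> * w j) * (B j k * u k)" for k
        by (simp add: B_def right_diff_distrib exp_diff exp_minus field_simps)
      then have "(\<Sum>\<^sub>\<infinity>k. A j k * (exp (- \<epsilon> * w k) * u k)) = exp (- \<epsilon> * w j) * (\<Sum>\<^sub>\<infinity>k. B j k * u k)"
        by (simp only: infsum_cmult_right')
      then show "(\<Sum>\<^sub>\<infinity>k. gauss_matrix lam x j k * (exp (- \<epsilon> * w k) * u k)) = (if j = l then 1 else 0)"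
        by (simp add: u(2) A_def w_def)
    qed
  qed
  show ?thesis
    by (rule that[OF C \<epsilon>]) (rule main)
qed

section \<open>Injectivity on \<open>ell2\<close> and the columns of the inverse\<close>

lemma ell2_bounded:
  assumes "a \<in> ell2"
  obtains K where "\<And>k. norm (a k) \<le> K"
proof (rule that)
  fix k
  have "(norm (a k))\<^sup>2 \<le> (\<Sum>\<^sub>\<infinity>k. (norm (a k))\<^sup>2)"
    using finite_sum_le_infsum[of "\<lambda>k. (norm (a k))\<^sup>2" UNIV "{k}"] assms by (simp add: ell2_def)
  then show "norm (a k) \<le> sqrt (\<Sum>\<^sub>\<infinity>k. (norm (a k))\<^sup>2)"
    by (rule real_le_rsqrt)
qed

lemma gauss_matrix_row_bound:
  fixes q lam :: real
  assumes q: "q > 0" and lam: "lam > 0"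
    and sep: "separated q x"
  obtains G where "\<And>j S. finite S \<Longrightarrow> (\<Sum>k\<in>S. gauss_matrix lam x j k) \<le> G"
proof -
  obtain G where "G > 0" and G: "\<And>(x :: int \<Rightarrow> real) t F. separated q x \<Longrightarrow> finite F \<Longrightarrow>
       (\<Sum>k\<in>F. exp (\<bar>t - x k\<bar> - lam * (t - x k)\<^sup>2)) \<le> G"
    using separated_gauss_sum_bound[OF q lam] by blast
  show ?thesis
  proof (rule that)
    fix j and S :: "int set" assume S: "finite S"
    have "(\<Sum>k\<in>S. gauss_matrix lam x j k) \<le> (\<Sum>k\<in>S. exp (\<bar>x j - x k\<bar> - lam * (x j - x k)\<^sup>2))"
      by (intro sum_mono) (simp add: gauss_matrix_def)
    also have "\<dots> \<le> G" by (rule G[OF sep S])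
    finally show "(\<Sum>k\<in>S. gauss_matrix lam x j k) \<le> G" .
  qed
qed

lemma gauss_row_summable:
  fixes q lam :: real
  assumes q: "q > 0" and lam: "lam > 0"
    and sep: "separated q x"
    and a: "\<And>k. norm (a k) \<le> K"
  shows "(\<lambda>k. complex_of_real (gauss_matrix lam x j k) * a k) summable_on UNIV"
proof -
  obtain G where G: "\<And>j S. finite S \<Longrightarrow> (\<Sum>k\<in>S. gauss_matrix lam x j k) \<le> G"
    using gauss_matrix_row_bound[OF q lam sep] by blast
  have A0: "gauss_matrix lam x j k \<ge> 0" for k by (simp add: gauss_matrix_def)
  have "(\<lambda>k. gauss_matrix lam x j k * K) summable_on UNIV"
    by (intro summable_on_cmult_left summable_on_bounded[where G = G]) (use G A0 in simp)
  then have "(\<lambda>k. norm (complex_of_real (gauss_matrix lam x j k) * a k)) summable_on UNIV"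
    by (rule Infinite_Sum.abs_summable_on_comparison_test')
       (use a A0 in \<open>auto simp: norm_mult intro!: mult_left_mono\<close>)
  then show ?thesis by (rule Infinite_Sum.abs_summable_summable)
qed

lemma gauss_op_decaying_solution:
  fixes q lam :: real
  assumes q: "q > 0" and lam: "lam > 0"
  obtains C \<epsilon> :: real where "C > 0" "0 < \<epsilon>" "\<epsilon> \<le> 1"
    "\<And>(x :: int \<Rightarrow> real) l. separated q x \<Longrightarrow>
       \<exists>c. (\<forall>k. norm (c k) \<le> C * exp (- \<epsilon> * \<bar>x k - x l\<bar>)) \<and> gauss_op lam x c = std_basis l"
proof -
  obtain C \<epsilon> :: real where C: "C > 0" "0 < \<epsilon>" "\<epsilon> \<le> 1" and ex:
    "\<And>(x :: int \<Rightarrow> real) l. separated q x \<Longrightarrow>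
       \<exists>c. (\<forall>k. \<bar>c k\<bar> \<le> C * exp (- \<epsilon> * \<bar>x k - x l\<bar>)) \<and>
           (\<forall>j. (\<Sum>\<^sub>\<infinity>k. gauss_matrix lam x j k * c k) = (if j = l then 1 else 0))"
    using gauss_decaying_solution[OF q lam] by blast
  have main: "\<exists>c. (\<forall>k. norm (c k) \<le> C * exp (- \<epsilon> * \<bar>x k - x l\<bar>)) \<and> gauss_op lam x c = std_basis l"
    if sep: "separated q x" for x :: "int \<Rightarrow> real" and l
  proof -
    obtain c where c: "\<And>k. \<bar>c k\<bar> \<le> C * exp (- \<epsilon> * \<bar>x k - x l\<bar>)"
      "\<And>j. (\<Sum>\<^sub>\<infinity>k. gauss_matrix lam x j k * c k) = (if j = l then 1 else 0)"
      using ex[OF sep, of l] by blast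
    have "gauss_op lam x (\<lambda>k. complex_of_real (c k)) = std_basis l"
    proof
      fix j
      have "(\<lambda>k. norm (gauss_matrix lam x j k * c k)) summable_on UNIV"
      proof (rule Infinite_Sum.abs_summable_on_comparison_test')
        show "(\<lambda>k. C * exp (- \<epsilon> * \<bar>x k - x l\<bar>)) summable_on UNIV"
          by (intro summable_on_cmult_right separated_exp_summable[OF q C(2) sep])
        show "norm (gauss_matrix lam x j k * c k) \<le> C * exp (- \<epsilon> * \<bar>x k - x l\<bar>)" for k
        proof -
          have "gauss_matrix lam x j k * \<bar>c k\<bar> \<le> 1 * \<bar>c k\<bar>"
            using lam by (intro mult_right_mono) (auto simp: gauss_matrix_def)
          with c(1)[of k] show ?thesis by (simp add: abs_mult gauss_matrix_def)
        qed
      qed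
      then have "((\<lambda>k. gauss_matrix lam x j k * c k) has_sum (if j = l then 1 else 0)) UNIV"
        unfolding c(2)[of j, symmetric] by (rule has_sum_infsum[OF Infinite_Sum.abs_summable_summable])
      from infsumI[OF has_sum_of_real[where 'a = complex, OF this]]
      show "gauss_op lam x (\<lambda>k. complex_of_real (c k)) j = std_basis l j"
        by (simp add: gauss_op_def std_basis_def)
    qed
    with c(1) show ?thesis by (intro exI[of _ "\<lambda>k. complex_of_real (c k)"]) simp
  qed
  show ?thesis by (rule that[OF C]) (rule main)
qed

text \<open>Testing the equation \<open>A d = 0\<close> against the decaying solution of \<open>A c = e\<^sub>l\<close> yields
  \<open>d l = 0\<close>, because \<open>A\<close> is symmetric.\<close>

lemma gauss_op_inj_on_ell2:
  fixes q lam :: real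
  assumes q: "q > 0" and lam: "lam > 0"
    and sep: "separated q x"
  shows "inj_on (gauss_op lam x) ell2"
proof (rule inj_onI, rule ext)
  fix a b l assume ab: "a \<in> ell2" "b \<in> ell2" "gauss_op lam x a = gauss_op lam x b"
  define A where "A = (\<lambda>j k. complex_of_real (gauss_matrix lam x j k))"
  have nA: "norm (A j k) = gauss_matrix lam x j k" and A0: "gauss_matrix lam x j k \<ge> 0"
    and Asym: "A j k = A k j" for j k
    by (simp_all add: A_def gauss_matrix_def power2_commute)
  obtain Ka where Ka: "\<And>k. norm (a k) \<le> Ka" using ell2_bounded[OF ab(1)] by blast
  obtain Kb where Kb: "\<And>k. norm (b k) \<le> Kb" using ell2_bounded[OF ab(2)] by blast
  define d where "d = (\<lambda>k. a k - b k)"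
  define K where "K = Ka + Kb"
  have d: "norm (d k) \<le> K" for k
    using norm_triangle_ineq4[of "a k" "b k"] Ka[of k] Kb[of k] by (simp add: d_def K_def)
  have Ad: "(\<Sum>\<^sub>\<infinity>k. A j k * d k) = 0" for j
  proof -
    have "((\<lambda>k. A j k * a k + - (A j k * b k)) has_sum
        (\<Sum>\<^sub>\<infinity>k. A j k * a k) + - (\<Sum>\<^sub>\<infinity>k. A j k * b k)) UNIV"
      unfolding A_def
      by (intro has_sum_add has_sum_uminusI has_sum_infsum
          gauss_row_summable[OF q lam sep Ka] gauss_row_summable[OF q lam sep Kb])
    from infsumI[OF this]
    have "(\<Sum>\<^sub>\<infinity>k. A j k * d k) = (\<Sum>\<^sub>\<infinity>k. A j k * a k) - (\<Sum>\<^sub>\<infinity>k. A j k * b k)"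
      by (simp add: d_def right_diff_distrib)
    also have "\<dots> = 0" using fun_cong[OF ab(3), of j] by (simp add: gauss_op_def A_def)
    finally show ?thesis .
  qed
  obtain C \<epsilon> :: real where C: "C > 0" "0 < \<epsilon>" "\<epsilon> \<le> 1" and ex:
    "\<And>(x :: int \<Rightarrow> real) l. separated q x \<Longrightarrow>
       \<exists>c. (\<forall>k. norm (c k) \<le> C * exp (- \<epsilon> * \<bar>x k - x l\<bar>)) \<and> gauss_op lam x c = std_basis l"
    using gauss_op_decaying_solution[OF q lam] by blast
  obtain c where c: "\<And>k. norm (c k) \<le> C * exp (- \<epsilon> * \<bar>x k - x l\<bar>)" "gauss_op lam x c = std_basis l"
    using ex[OF sep, of l] by blast
  have cs: "(\<lambda>k. norm (c k)) summable_on UNIV"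
    by (rule summable_on_comparison_test[OF summable_on_cmult_right[OF separated_exp_summable[OF q C(2) sep]]])
       (use c(1) in auto)
  obtain G where G: "\<And>j S. finite S \<Longrightarrow> (\<Sum>k\<in>S. gauss_matrix lam x j k) \<le> G"
    using gauss_matrix_row_bound[OF q lam sep] by blast
  have rs: "gauss_matrix lam x j summable_on UNIV" for j
    by (rule summable_on_bounded[where G = G]) (use G A0 in simp)
  \<comment> \<open>Absolute convergence over pairs, for the exchange of sums: \<open>d\<close> is
    bounded, the rows of the matrix have uniformly bounded sums, and \<open>c\<close> is summable by
    its decay.\<close>
  have "(\<lambda>(j, k). norm (c j) * (gauss_matrix lam x j k * K)) summable_on UNIV \<times> UNIV"
  proof (rule summable_on_SigmaI)
    show "((\<lambda>k. case (j, k) of (j, k) \<Rightarrow> norm (c j) * (gauss_matrix lam x j k * K)) has_sum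
            norm (c j) * ((\<Sum>\<^sub>\<infinity>k. gauss_matrix lam x j k) * K)) UNIV" for j
      unfolding prod.case by (intro has_sum_cmult_right has_sum_cmult_left has_sum_infsum rs)
    have "(\<Sum>\<^sub>\<infinity>k. gauss_matrix lam x j k) \<le> G" for j
      by (rule infsum_le_finite_sums[OF rs]) (use G in auto)
    moreover have "0 \<le> K" using d[of 0] norm_ge_zero[of "d 0"] by linarith
    ultimately show "(\<lambda>j. norm (c j) * ((\<Sum>\<^sub>\<infinity>k. gauss_matrix lam x j k) * K)) summable_on UNIV"
      by (intro summable_on_comparison_test[OF summable_on_cmult_left[OF cs, of "G * K"]])
         (auto intro!: mult_left_mono mult_right_mono mult_nonneg_nonneg infsum_nonneg A0)
    show "0 \<le> (case (j, k) of (j, k) \<Rightarrow> norm (c j) * (gauss_matrix lam x j k * K))" for j k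
      using \<open>0 \<le> K\<close> A0 by simp
  qed
  then have "(\<lambda>p. norm (case p of (j, k) \<Rightarrow> c j * (A j k * d k))) summable_on UNIV \<times> UNIV"
    by (rule Infinite_Sum.abs_summable_on_comparison_test')
       (auto simp: norm_mult nA intro!: mult_left_mono d A0)
  then have prod: "(\<lambda>(j, k). c j * (A j k * d k)) summable_on UNIV \<times> UNIV"
    by (rule Infinite_Sum.abs_summable_summable)
  have "0 = (\<Sum>\<^sub>\<infinity>j. c j * (\<Sum>\<^sub>\<infinity>k. A j k * d k))"
    by (simp add: Ad)
  also have "\<dots> = (\<Sum>\<^sub>\<infinity>j. \<Sum>\<^sub>\<infinity>k. c j * (A j k * d k))"
    by (simp only: infsum_cmult_right')
  also have "\<dots> = (\<Sum>\<^sub>\<infinity>k. \<Sum>\<^sub>\<infinity>j. c j * (A j k * d k))"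
    by (rule infsum_swap_banach[OF prod])
  also have "\<dots> = (\<Sum>\<^sub>\<infinity>k. (\<Sum>\<^sub>\<infinity>j. A k j * c j) * d k)"
  proof (rule infsum_cong)
    fix k
    have "c j * (A j k * d k) = A k j * c j * d k" for j by (simp add: Asym[of j k])
    then show "(\<Sum>\<^sub>\<infinity>j. c j * (A j k * d k)) = (\<Sum>\<^sub>\<infinity>j. A k j * c j) * d k"
      by (simp only: infsum_cmult_left')
  qed
  also have "\<dots> = (\<Sum>\<^sub>\<infinity>k. if k = l then d l else 0)"
    using fun_cong[OF c(2)] by (intro infsum_cong) (simp add: gauss_op_def A_def std_basis_def)
  also have "\<dots> = (\<Sum>\<^sub>\<infinity>k\<in>{l}. d l)"
    by (rule infsum_cong_neutral) auto
  finally show "a l = b l" by (simp add: d_def)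
qed

text \<open>Decay puts the constructed solution into \<open>ell2\<close>, and injectivity forces
  \<open>inv_into\<close> to return exactly this preimage. The column of the inverse thus inherits
  the decay with unchanged constants.\<close>

lemma gauss_inv_column:
  fixes q lam :: real
  assumes q: "q > 0" and lam: "lam > 0"
  obtains C \<epsilon> :: real where "C > 0" "0 < \<epsilon>" "\<epsilon> \<le> 1"
    "\<And>(x :: int \<Rightarrow> real) k l. separated q x \<Longrightarrow>
       norm (gauss_inv lam x k l) \<le> C * exp (- \<epsilon> * \<bar>x k - x l\<bar>)"
    "\<And>(x :: int \<Rightarrow> real) l. separated q x \<Longrightarrow>
       gauss_op lam x (\<lambda>k. gauss_inv lam x k l) = std_basis l"
proof -
  obtain C \<epsilon> :: real where C: "C > 0" "0 < \<epsilon>" "\<epsilon> \<le> 1" and ex: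
    "\<And>(x :: int \<Rightarrow> real) l. separated q x \<Longrightarrow>
       \<exists>c. (\<forall>k. norm (c k) \<le> C * exp (- \<epsilon> * \<bar>x k - x l\<bar>)) \<and> gauss_op lam x c = std_basis l"
    using gauss_op_decaying_solution[OF q lam] by blast
  have main: "norm (gauss_inv lam x k l) \<le> C * exp (- \<epsilon> * \<bar>x k - x l\<bar>) \<and>
      gauss_op lam x (\<lambda>k. gauss_inv lam x k l) = std_basis l"
    if sep: "separated q x" for x :: "int \<Rightarrow> real" and k l
  proof -
    obtain c where c: "\<And>k. norm (c k) \<le> C * exp (- \<epsilon> * \<bar>x k - x l\<bar>)" "gauss_op lam x c = std_basis l"
      using ex[OF sep, of l] by blast
    have cC: "norm (c k) \<le> C" for k
    proof -
      have "C * exp (- \<epsilon> * \<bar>x k - x l\<bar>) \<le> C * 1" using C by (intro mult_left_mono) auto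
      with c(1)[of k] show ?thesis by simp
    qed
    have "(\<lambda>k. C * (C * exp (- \<epsilon> * \<bar>x k - x l\<bar>))) summable_on UNIV"
      by (intro summable_on_cmult_right separated_exp_summable[OF q C(2) sep])
    then have "(\<lambda>k. (norm (c k))\<^sup>2) summable_on UNIV"
    proof (rule summable_on_comparison_test)
      show "(norm (c k))\<^sup>2 \<le> C * (C * exp (- \<epsilon> * \<bar>x k - x l\<bar>))" for k
        unfolding power2_eq_square by (intro mult_mono cC c(1)) (use C in auto)
    qed simp
    then have "c \<in> ell2" by (simp add: ell2_def)
    then have "inv_into ell2 (gauss_op lam x) (std_basis l) = c"
      using inv_into_f_f[OF gauss_op_inj_on_ell2[OF q lam sep]] c(2) by metis
    then have "(\<lambda>k. gauss_inv lam x k l) = c" by (simp add: gauss_inv_def fun_eq_iff)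
    with c show ?thesis by (simp add: fun_eq_iff)
  qed
  show ?thesis
    by (rule that[OF C]) (use main in blast)+
qed

section \<open>Fundamental functions and their series\<close>

text \<open>The Weierstrass M-test along the net of finite partial sums, which converges uniformly
  on \<open>T\<close>.\<close>

lemma continuous_on_infsum_dominated:
  fixes f :: "'i \<Rightarrow> 'a :: topological_space \<Rightarrow> 'b :: banach"
  assumes "\<And>i t. t \<in> T \<Longrightarrow> norm (f i t) \<le> M i" and "M summable_on UNIV"
    and "\<And>i. continuous_on T (f i)"
  shows "continuous_on T (\<lambda>t. \<Sum>\<^sub>\<infinity>i. f i t)"
  by (rule uniform_limit_theorem[OF _ Weierstrass_m_test_general[of UNIV T f M]])
     (use assms in \<open>auto intro!: always_eventually continuous_on_sum\<close>)

lemma power_le_fact_mult_exp: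
  fixes y :: real
  assumes "0 \<le> y"
  shows "y ^ n \<le> fact n * exp y"
proof -
  have "sum (\<lambda>n. y ^ n /\<^sub>R fact n) {n} \<le> exp y"
    unfolding exp_def by (rule sum_le_suminf[OF summable_exp_generic]) (use assms in auto)
  then show ?thesis by (simp add: field_simps)
qed

lemma fundamental_fun_properties:
  fixes q lam :: real
  assumes q: "q > 0" and lam: "lam > 0"
  obtains \<beta> \<epsilon> :: real where "\<beta> > 0" "0 < \<epsilon>"
    "\<And>(x :: int \<Rightarrow> real) l t. separated q x \<Longrightarrow>
       (\<lambda>k. gauss_inv lam x k l * complex_of_real (exp (- lam * (t - x k)\<^sup>2))) summable_on UNIV"
    "\<And>(x :: int \<Rightarrow> real) l. separated q x \<Longrightarrow>
       continuous_on UNIV (fundamental_fun lam x l)"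
    "\<And>(x :: int \<Rightarrow> real) l m. separated q x \<Longrightarrow>
       fundamental_fun lam x l (x m) = (if l = m then 1 else 0)"
    "\<And>(x :: int \<Rightarrow> real) l t. separated q x \<Longrightarrow>
       norm (fundamental_fun lam x l t) \<le> \<beta> * exp (- \<epsilon> * \<bar>t - x l\<bar>)"
proof -
  obtain C \<epsilon> :: real where C: "C > 0" "0 < \<epsilon>" "\<epsilon> \<le> 1"
    and bound: "\<And>(x :: int \<Rightarrow> real) k l. separated q x \<Longrightarrow>
       norm (gauss_inv lam x k l) \<le> C * exp (- \<epsilon> * \<bar>x k - x l\<bar>)"
    and inverse: "\<And>(x :: int \<Rightarrow> real) l. separated q x \<Longrightarrow>
       gauss_op lam x (\<lambda>k. gauss_inv lam x k l) = std_basis l"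
    using gauss_inv_column[OF q lam] by blast
  obtain G where G: "G > 0"
    "\<And>(x :: int \<Rightarrow> real) t F. separated q x \<Longrightarrow> finite F \<Longrightarrow>
       (\<Sum>k\<in>F. exp (\<bar>t - x k\<bar> - lam * (t - x k)\<^sup>2)) \<le> G"
    using separated_gauss_sum_bound[OF q lam] by blast
  define T where "T = (\<lambda>x l k t. gauss_inv lam x k l * complex_of_real (exp (- lam * (t - x k)\<^sup>2)))"
  have T: "fundamental_fun lam x l = (\<lambda>t. \<Sum>\<^sub>\<infinity>k. T x l k t)" for x l
    by (simp add: fun_eq_iff fundamental_fun_def T_def)
  have Tb: "norm (T x l k t) \<le> C * exp (- \<epsilon> * \<bar>x k - x l\<bar>)"
    if sep: "separated q x" for x :: "int \<Rightarrow> real" and k l t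
  proof -
    have "norm (T x l k t) \<le> norm (gauss_inv lam x k l) * 1"
      unfolding T_def norm_mult using lam by (intro mult_left_mono) auto
    with bound[OF sep, of k l] show ?thesis by simp
  qed
  have Ms: "(\<lambda>k. C * exp (- \<epsilon> * \<bar>x k - x l\<bar>)) summable_on UNIV"
    if sep: "separated q x" for x :: "int \<Rightarrow> real" and l
    by (intro summable_on_cmult_right separated_exp_summable[OF q C(2) sep])
  have Ts: "(\<lambda>k. norm (T x l k t)) summable_on UNIV"
    if sep: "separated q x" for x :: "int \<Rightarrow> real" and l t
    by (rule Infinite_Sum.abs_summable_on_comparison_test'[OF Ms[OF sep, where l = l] Tb[OF sep]])
  show ?thesis
  proof (rule that[of "C * G" \<epsilon>])
    show "C * G > 0" using C G by simp
    show "0 < \<epsilon>" by (rule C)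
    fix x :: "int \<Rightarrow> real" and l
    assume sep: "separated q x"
    show "(\<lambda>k. gauss_inv lam x k l * complex_of_real (exp (- lam * (t - x k)\<^sup>2))) summable_on UNIV" for t
      using Infinite_Sum.abs_summable_summable[OF Ts[OF sep, of l t]] by (simp only: T_def)
    show "continuous_on UNIV (fundamental_fun lam x l)"
      unfolding T
      by (rule continuous_on_infsum_dominated[OF Tb[OF sep] Ms[OF sep]])
         (auto simp: T_def intro!: continuous_intros)
    \<comment> \<open>At \<open>t = x m\<close> the Gaussians form row \<open>m\<close> of the
      matrix, so the series is coordinate \<open>m\<close> of the matrix applied to column
      \<open>l\<close> of its inverse.\<close>
    show "fundamental_fun lam x l (x m) = (if l = m then 1 else 0)" for m
      using fun_cong[OF inverse[OF sep, of l], of m]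
      by (simp add: fundamental_fun_def gauss_op_def gauss_matrix_def std_basis_def mult.commute)
    show "norm (fundamental_fun lam x l t) \<le> C * G * exp (- \<epsilon> * \<bar>t - x l\<bar>)" for t
    proof -
      have "norm (fundamental_fun lam x l t) \<le> (\<Sum>\<^sub>\<infinity>k. norm (T x l k t))"
        unfolding T by (rule norm_infsum_bound[OF Ts[OF sep]])
      also have "\<dots> \<le> C * G * exp (- \<epsilon> * \<bar>t - x l\<bar>)"
      proof (rule infsum_le_finite_sums[OF Ts[OF sep]])
        fix F :: "int set" assume F: "finite F"
        have "norm (T x l k t) \<le> C * exp (- \<epsilon> * \<bar>t - x l\<bar>) * exp (\<bar>t - x k\<bar> - lam * (t - x k)\<^sup>2)" for k
        proof -
          \<comment> \<open>The triangle inequality moves the decay from \<open>x k\<close> to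
            \<open>t\<close>; the resulting loss in \<open>\<bar>t - x k\<bar>\<close> has rate at
            most 1 and is absorbed by the Gaussian.\<close>
          have "\<epsilon> * \<bar>t - x l\<bar> \<le> \<epsilon> * \<bar>t - x k\<bar> + \<epsilon> * \<bar>x k - x l\<bar>"
            unfolding distrib_left[symmetric] using C by (intro mult_left_mono) auto
          moreover have "\<epsilon> * \<bar>t - x k\<bar> \<le> 1 * \<bar>t - x k\<bar>"
            using C by (intro mult_right_mono) auto
          ultimately have "exp (- \<epsilon> * \<bar>x k - x l\<bar>) * exp (- lam * (t - x k)\<^sup>2) \<le>
              exp (- \<epsilon> * \<bar>t - x l\<bar>) * exp (\<bar>t - x k\<bar> - lam * (t - x k)\<^sup>2)"
            by (simp add: exp_add[symmetric])
          then have "C * (exp (- \<epsilon> * \<bar>x k - x l\<bar>) * exp (- lam * (t - x k)\<^sup>2)) \<le>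
              C * (exp (- \<epsilon> * \<bar>t - x l\<bar>) * exp (\<bar>t - x k\<bar> - lam * (t - x k)\<^sup>2))"
            using C by (intro mult_left_mono) auto
          moreover have "norm (T x l k t) \<le> C * exp (- \<epsilon> * \<bar>x k - x l\<bar>) * exp (- lam * (t - x k)\<^sup>2)"
            unfolding T_def norm_mult norm_of_real abs_exp_cancel
            by (intro mult_right_mono bound[OF sep]) simp
          ultimately show ?thesis by (simp only: mult.assoc)
        qed
        then have "(\<Sum>k\<in>F. norm (T x l k t)) \<le>
            (\<Sum>k\<in>F. C * exp (- \<epsilon> * \<bar>t - x l\<bar>) * exp (\<bar>t - x k\<bar> - lam * (t - x k)\<^sup>2))"
          by (intro sum_mono)
        also have "\<dots> \<le> C * exp (- \<epsilon> * \<bar>t - x l\<bar>) * G"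
          unfolding sum_distrib_left[symmetric] using C by (intro mult_left_mono G(2)[OF sep F]) auto
        finally show "(\<Sum>k\<in>F. norm (T x l k t)) \<le> C * G * exp (- \<epsilon> * \<bar>t - x l\<bar>)"
          by (simp add: mult_ac)
      qed
      finally show ?thesis .
    qed
  qed
qed

text \<open>Half of the exponential absorbs the power, since a single term of the exponential series
  bounds \<open>y ^ P\<close> by \<open>fact P * exp y\<close>; the other half is summable.\<close>

lemma polynomial_exp_summable:
  fixes a :: real
  assumes "a > 0"
  shows "(\<lambda>l::int. \<bar>real_of_int l\<bar> ^ P * exp (- a * \<bar>real_of_int l\<bar>)) summable_on UNIV"
proof (rule summable_on_comparison_test)
  have "(\<lambda>l. exp (- (a / 2) * \<bar>real_of_int l - 0\<bar>)) summable_on UNIV"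
    by (rule separated_exp_summable[where q = 1]) (use assms in \<open>auto simp: separated_def\<close>)
  then show "(\<lambda>l. fact P / (a / 2) ^ P * exp (- (a / 2) * \<bar>real_of_int l\<bar>)) summable_on UNIV"
    by (intro summable_on_cmult_right) simp
  fix l :: int
  define y where "y = a / 2 * \<bar>real_of_int l\<bar>"
  have "y ^ P * exp (- 2 * y) \<le> fact P * exp y * exp (- 2 * y)"
    using assms by (intro mult_right_mono power_le_fact_mult_exp) (auto simp: y_def)
  also have "\<dots> = fact P * exp (- y)" by (simp add: mult.assoc exp_add[symmetric])
  also have "y ^ P * exp (- 2 * y) = (a / 2) ^ P * (\<bar>real_of_int l\<bar> ^ P * exp (- a * \<bar>real_of_int l\<bar>))"
    unfolding y_def power_mult_distrib by simp
  finally have "(a / 2) ^ P * (\<bar>real_of_int l\<bar> ^ P * exp (- a * \<bar>real_of_int l\<bar>)) \<le> fact P * exp (- y)" .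
  then show "\<bar>real_of_int l\<bar> ^ P * exp (- a * \<bar>real_of_int l\<bar>) \<le>
      fact P / (a / 2) ^ P * exp (- (a / 2) * \<bar>real_of_int l\<bar>)"
    using assms by (simp add: y_def field_simps)
qed auto

text \<open>Summability is claimed next to continuity because \<open>infsum\<close> is 0 on families
  that are not summable. The constants \<open>\<beta>\<^sub>2\<close> and \<open>\<rho>\<close> are
  quantified before \<open>x\<close>, which expresses on what they may depend.\<close>

theorem theorem6p7:
  fixes lam q :: real
  assumes "lam > 0" and "q > 0"
  shows
    "(\<forall>x :: int \<Rightarrow> real. (\<forall>j. x (j + 1) - x j \<ge> q) \<longrightarrow>
        (\<forall>l. (\<forall>t. (\<lambda>k. gauss_inv lam x k l * complex_of_real (exp (- lam * (t - x k)\<^sup>2)))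
                     summable_on UNIV)
            \<and> continuous_on UNIV (fundamental_fun lam x l)
            \<and> (\<forall>m. fundamental_fun lam x l (x m) = (if l = m then 1 else 0))))
   \<and> (\<forall>Q > 0. \<exists>\<beta>\<^sub>2 > 0. \<exists>\<rho> > 0. \<forall>x :: int \<Rightarrow> real.
        (\<forall>j. x (j + 1) - x j \<ge> q) \<and> (\<forall>j. x (j + 1) - x j \<le> Q) \<longrightarrow>
        (\<forall>t l. norm (fundamental_fun lam x l t) \<le> \<beta>\<^sub>2 * exp (- \<rho> * \<bar>t - x l\<bar>)))
   \<and> (\<forall>Q > 0. \<forall>x :: int \<Rightarrow> real.
        (\<forall>j. x (j + 1) - x j \<ge> q) \<and> (\<forall>j. x (j + 1) - x j \<le> Q) \<longrightarrow>
        (\<forall>b :: int \<Rightarrow> complex.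
          (\<exists>K :: real. \<exists>P :: nat. K > 0 \<and> P > 0 \<and> (\<forall>l. norm (b l) \<le> K * \<bar>real_of_int l\<bar> ^ P)) \<longrightarrow>
          (\<forall>t. (\<lambda>l. b l * fundamental_fun lam x l t) summable_on UNIV)
          \<and> continuous_on UNIV (\<lambda>t. \<Sum>\<^sub>\<infinity>l. b l * fundamental_fun lam x l t)))"
proof -
  note lam = assms(1) and q = assms(2)
  obtain \<beta> \<epsilon> :: real where \<beta>: "\<beta> > 0" "0 < \<epsilon>"
    and sm: "\<And>(x :: int \<Rightarrow> real) l t. separated q x \<Longrightarrow>
       (\<lambda>k. gauss_inv lam x k l * complex_of_real (exp (- lam * (t - x k)\<^sup>2))) summable_on UNIV"
    and cont: "\<And>(x :: int \<Rightarrow> real) l. separated q x \<Longrightarrow>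
       continuous_on UNIV (fundamental_fun lam x l)"
    and interp: "\<And>(x :: int \<Rightarrow> real) l m. separated q x \<Longrightarrow>
       fundamental_fun lam x l (x m) = (if l = m then 1 else 0)"
    and decay: "\<And>(x :: int \<Rightarrow> real) l t. separated q x \<Longrightarrow>
       norm (fundamental_fun lam x l t) \<le> \<beta> * exp (- \<epsilon> * \<bar>t - x l\<bar>)"
    using fundamental_fun_properties[OF q lam] by blast
  have series: "(\<forall>t. (\<lambda>l. b l * fundamental_fun lam x l t) summable_on UNIV) \<and>
      continuous_on UNIV (\<lambda>t. \<Sum>\<^sub>\<infinity>l. b l * fundamental_fun lam x l t)"
    if gap: "\<And>j. x (j + 1) - x j \<ge> q" and K: "K > 0"
      and b: "\<And>l. norm (b l) \<le> K * \<bar>real_of_int l\<bar> ^ P"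
    for x :: "int \<Rightarrow> real" and b :: "int \<Rightarrow> complex" and K P
  proof -
    note sep = separated_gapI[of q x, OF gap]
    \<comment> \<open>A majorant on the unit ball around \<open>s\<close>: there
      \<open>\<bar>t\<bar>\<close> is at most \<open>\<bar>s\<bar> + 1\<close>, so
      \<open>q * \<bar>l\<bar> \<le> \<bar>x l - x 0\<bar>\<close> converts decay in the distance
      from \<open>t\<close> to \<open>x l\<close> into decay in \<open>l\<close>.\<close>
    define M where "M = (\<lambda>s l. K * \<beta> * exp (\<epsilon> * (\<bar>s\<bar> + 1 + \<bar>x 0\<bar>)) *
        (\<bar>real_of_int l\<bar> ^ P * exp (- (\<epsilon> * q) * \<bar>real_of_int l\<bar>)))"
    have M: "M s summable_on UNIV" for s
      unfolding M_def by (intro summable_on_cmult_right polynomial_exp_summable mult_pos_pos \<beta>(2) q)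
    have dom: "norm (b l * fundamental_fun lam x l t) \<le> M s l" if t: "t \<in> ball s 1" for s t l
    proof -
      have "q * \<bar>real_of_int l\<bar> \<le> \<bar>t - x l\<bar> + (\<bar>s\<bar> + 1 + \<bar>x 0\<bar>)"
        using separatedD[OF sep, of l 0] t by (auto simp: dist_real_def)
      then have "\<epsilon> * (q * \<bar>real_of_int l\<bar>) \<le> \<epsilon> * (\<bar>t - x l\<bar> + (\<bar>s\<bar> + 1 + \<bar>x 0\<bar>))"
        using \<beta> by (intro mult_left_mono) auto
      then have e: "exp (- \<epsilon> * \<bar>t - x l\<bar>) \<le>
          exp (\<epsilon> * (\<bar>s\<bar> + 1 + \<bar>x 0\<bar>)) * exp (- (\<epsilon> * q) * \<bar>real_of_int l\<bar>)"
        unfolding exp_add[symmetric] exp_le_cancel_iff by (simp add: algebra_simps)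
      have "norm (b l * fundamental_fun lam x l t) \<le> (K * \<bar>real_of_int l\<bar> ^ P) * (\<beta> * exp (- \<epsilon> * \<bar>t - x l\<bar>))"
        unfolding norm_mult using K by (intro mult_mono b decay[OF sep]) auto
      also have "\<dots> \<le> (K * \<bar>real_of_int l\<bar> ^ P) *
          (\<beta> * (exp (\<epsilon> * (\<bar>s\<bar> + 1 + \<bar>x 0\<bar>)) * exp (- (\<epsilon> * q) * \<bar>real_of_int l\<bar>)))"
        using K \<beta> by (intro mult_left_mono e) auto
      also have "\<dots> = M s l" by (simp only: M_def mult_ac)
      finally show ?thesis .
    qed
    show ?thesis
    proof (intro conjI allI)
      fix t
      show "(\<lambda>l. b l * fundamental_fun lam x l t) summable_on UNIV"
        by (rule Infinite_Sum.abs_summable_summable[OF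
              Infinite_Sum.abs_summable_on_comparison_test'[OF M[of t] dom]]) simp
    next
      \<comment> \<open>The majorant depends on \<open>s\<close>, so continuity is first obtained on
        unit balls and then at each centre.\<close>
      have local: "continuous_on (ball s 1) (\<lambda>t. \<Sum>\<^sub>\<infinity>l. b l * fundamental_fun lam x l t)" for s
        by (rule continuous_on_infsum_dominated[OF dom M])
           (auto intro!: continuous_intros continuous_on_subset[OF cont[OF sep]])
      have "isCont (\<lambda>t. \<Sum>\<^sub>\<infinity>l. b l * fundamental_fun lam x l t) s" for s
        using local[of s] by (rule continuous_on_interior) simp
      then show "continuous_on UNIV (\<lambda>t. \<Sum>\<^sub>\<infinity>l. b l * fundamental_fun lam x l t)"
        by (intro continuous_at_imp_continuous_on) blast
    qed
  qed
  show ?thesis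
  proof (intro conjI allI impI)
    fix x :: "int \<Rightarrow> real" and l assume "\<forall>j. x (j + 1) - x j \<ge> q"
    then have sep: "separated q x" by (intro separated_gapI) auto
    show "(\<lambda>k. gauss_inv lam x k l * complex_of_real (exp (- lam * (t - x k)\<^sup>2))) summable_on UNIV" for t
      by (rule sm[OF sep])
    show "continuous_on UNIV (fundamental_fun lam x l)" by (rule cont[OF sep])
    show "fundamental_fun lam x l (x m) = (if l = m then 1 else 0)" for m by (rule interp[OF sep])
  next
    fix Q :: real
    have "norm (fundamental_fun lam x l t) \<le> \<beta> * exp (- \<epsilon> * \<bar>t - x l\<bar>)"
      if "\<forall>j. x (j + 1) - x j \<ge> q" for x l t
      by (rule decay, rule separated_gapI) (use that in auto)
    with \<beta> show "\<exists>\<beta>\<^sub>2 > 0. \<exists>\<rho> > 0. \<forall>x :: int \<Rightarrow> real.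
        (\<forall>j. x (j + 1) - x j \<ge> q) \<and> (\<forall>j. x (j + 1) - x j \<le> Q) \<longrightarrow>
        (\<forall>t l. norm (fundamental_fun lam x l t) \<le> \<beta>\<^sub>2 * exp (- \<rho> * \<bar>t - x l\<bar>))"
      by blast
  next
    fix Q :: real and x :: "int \<Rightarrow> real" and b :: "int \<Rightarrow> complex" and t
    assume gap: "(\<forall>j. x (j + 1) - x j \<ge> q) \<and> (\<forall>j. x (j + 1) - x j \<le> Q)"
      and "\<exists>K :: real. \<exists>P :: nat. K > 0 \<and> P > 0 \<and> (\<forall>l. norm (b l) \<le> K * \<bar>real_of_int l\<bar> ^ P)"
    then obtain K P where "K > 0" "\<And>l. norm (b l) \<le> K * \<bar>real_of_int l\<bar> ^ P" by blast
    then have *: "(\<forall>t. (\<lambda>l. b l * fundamental_fun lam x l t) summable_on UNIV) \<and>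
        continuous_on UNIV (\<lambda>t. \<Sum>\<^sub>\<infinity>l. b l * fundamental_fun lam x l t)"
      using gap by (intro series) auto
    show "(\<lambda>l. b l * fundamental_fun lam x l t) summable_on UNIV" using * by blast
    show "continuous_on UNIV (\<lambda>t. \<Sum>\<^sub>\<infinity>l. b l * fundamental_fun lam x l t)" using * by blast
  qed
qed

end
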